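(* Let $F:\mathbb{R}^n\rightrightarrows\mathbb{R}^q$ be a polyhedral convex set-valued mapping with recession mapping $G$, and let $C\subseteq\mathbb{R}^q$ be a polyhedral convex cone with nonempty interior such that $G(0)=C$. Then the algorithm $\mathtt{Solve}(F,C)$ is correct and terminates after finitely many steps; that is, after finitely many steps it outputs a solution $(\bar S,\hat S)$ of (P) if (P) has a solution, and $(\bar S,\hat S)=(\emptyset,\emptyset)$ otherwise.
   Context: A set-valued mapping $F:\mathbb{R}^n\rightrightarrows\mathbb{R}^q$ is polyhedral convex if its graph $\mathrm{gr}\,F=\{(x,y)\in\mathbb{R}^n\times\mathbb{R}^q : y\in F(x)\}$ is a convex polyhedron; $\mathrm{dom}\,F=\{x : F(x)\ne\emptyset\}$. Polyhedral convex cones are nonempty (contain $0$). The recession mapping $G:\mathbb{R}^n\rightrightarrows\mathbb{R}^q$ of $F$ is defined by $\mathrm{gr}\,G=0^+\mathrm{gr}\,F$, where $0^+A=\{d : a+td\in A\ \forall a\in A,\ t\ge0\}$ is the recession cone. Problem (P) is: minimize $F(x)+C$ over $x\in\mathbb{R}^n$ with respect to the ordering $\supseteq$. Its upper image is the convex polyhedron $\mathcal{P}=C+\bigcup_{x\in\mathbb{R}^n}F(x)$. A pair $(\bar S,\hat S)$ of finite sets $\emptyset\ne\bar S\subseteq\mathrm{dom}\,F$ and $\hat S\subseteq\mathrm{dom}\,G\setminus\{0\}$ is a finite infimizer of (P) if $\mathcal{P}\subseteq C+\mathrm{conv}\bigcup_{x\in\bar S}F(x)+\mathrm{cone}\bigcup_{x\in\hat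 S}G(x)$, where $\mathrm{cone}\,Y$ is the smallest convex cone containing $Y$ and $\mathrm{cone}\,\emptyset=\{0\}$. A point $\bar x\in\mathrm{dom}\,F$ is a minimizing point of (P) if there is no $x\in\mathbb{R}^n$ with $F(x)+C\supsetneq F(\bar x)+C$. A nonzero $\hat x\in\mathrm{dom}\,G$ is a minimizing direction of (P) if there is no $x\in\mathbb{R}^n$ with $G(x)+C\supsetneq G(\hat x)+C$. A finite infimizer $(\bar S,\hat S)$ is a solution of (P) if all elements of $\bar S$ are minimizing points and all elements of $\hat S$ (if any) are minimizing directions. Minimal system of outer normals: for a polyhedral convex set $Q\subseteq\mathbb{R}^q$, the family $\{w^1,\dots,w^k\}$ of vectors arising from an inequality representation $Q=\{y : y^Tw^1\le\gamma_1,\dots,y^Tw^k\le\gamma_k\}$ with $\|w^1\|=\dots=\|w^k\|=1$ and $k$ minimal. If $Q$ has nonempty interior, these are the uniquely determined unit outer normals at the facets of $Q$. For a polyhedral convex mapping $H:\mathbb{R}^n\rightrightarrows\mathbb{R}^q$, $\bar x\in\mathrm{dom}\,H$ and $w\in\mathbb{R}^q$, $\mathrm{LP}(H,w,\bar x)$ is the linear program: maximize $w^Ty$ over $(x,y)\in\mathbb{R}^n\times\mathbb{R}^q$ subject to $y\in H(x)+C$ and $H(\bar x)+C\subseteq H(x)+C$. Procedure $\mathtt{ComputeMinimizer}(H,C,\bar y)$, for $\bar y\in C+\bigcup_{x}H(x)$: 1. Choose $\bar x\in\mathbb{R}^n$ with $\bar y\in H(\bar x)+C$. Let $N$ be the minimal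 system of outer normals of $H(\bar x)+C$, and let $W=\emptyset$. 2. While $N\not\subseteq W$: choose $w\in N\setminus W$ and replace $W$ by $W\cup\{w\}$. If $\mathrm{LP}(H,w,\bar x)$ has no optimal solution, return $\emptyset$ and stop; otherwise let $(x^*,y^* )$ be an optimal solution. If $y^*\notin H(\bar x)+C$, replace $\bar x$ by $x^*$ and replace $N$ by the minimal system of outer normals of the new set $H(\bar x)+C$. 3. Return $\{\bar x\}$. Algorithm $\mathtt{Solve}(F,C)$: 1. Set $\bar S=\emptyset$, $\hat S=\emptyset$. 2. If $\mathcal{P}=\emptyset$ or $\mathtt{ComputeMinimizer}(G,C,0)=\emptyset$, stop and output $(\emptyset,\emptyset)$. 3. Compute a V-representation of $\mathcal{P}$, i.e. a representation of $\mathcal{P}$ as the sum of the convex hull of finitely many points and the conic hull of finitely many directions; let $P$ be the finite set of these points and $D$ the finite set of those of these directions that do not belong to $C$. (This computation is regarded as available.) 4. For each $y\in P$ replace $\bar S$ by $\bar S\cup\mathtt{ComputeMinimizer}(F,C,y)$. 5. For each $y\in D$ replace $\hat S$ by $\hat S\cup\mathtt{ComputeMinimizer}(G,C,y)$. 6. Output $(\bar S,\hat S)$. All choices are arbitrary. *)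

theory Defs
  imports "HOL-Analysis.Analysis" "HOL-Library.Set_Algebras"
begin

section \<open>Polyhedral convex set-valued mappings\<close>

text \<open>
  A set-valued mapping is a function into sets. The sum \<open>A + B\<close> of two sets is the Minkowski sum
  of \<^theory>\<open>HOL-Library.Set_Algebras\<close>.
\<close>

definition graph_of :: "('a \<Rightarrow> 'b set) \<Rightarrow> ('a \<times> 'b) set" where
  "graph_of F = {(x, y). y \<in> F x}"

definition domain_of :: "('a \<Rightarrow> 'b set) \<Rightarrow> 'a set" where
  "domain_of F = {x. F x \<noteq> {}}"

definition polyhedral_convex :: "('a::euclidean_space \<Rightarrow> 'b::euclidean_space set) \<Rightarrow> bool" where
  "polyhedral_convex F \<longleftrightarrow> polyhedron (graph_of F)"

text \<open>For empty \<open>A\<close> this is the whole space.\<close>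

definition recession_cone :: "'a::real_vector set \<Rightarrow> 'a set" where
  "recession_cone A = {d. \<forall>a\<in>A. \<forall>t\<ge>0. a + t *\<^sub>R d \<in> A}"

definition recession_map :: "('a::real_vector \<Rightarrow> 'b::real_vector set) \<Rightarrow> 'a \<Rightarrow> 'b set" where
  "recession_map F x = {y. (x, y) \<in> recession_cone (graph_of F)}"

section \<open>The set optimization problem\<close>

definition upper_image :: "('a \<Rightarrow> 'b::plus set) \<Rightarrow> 'b set \<Rightarrow> 'b set" where
  "upper_image F C = C + (\<Union>x. F x)"

text \<open>
  \<open>convex_cone hull Y\<close> is the smallest convex cone with apex 0 that contains \<open>Y\<close>; library convex
  cones are nonempty, so \<open>convex_cone hull {} = {0}\<close>.
\<close>

definition finite_infimizer ::
  "('a::real_vector \<Rightarrow> 'b::real_vector set) \<Rightarrow> 'b set \<Rightarrow> 'a set \<Rightarrow> 'a set \<Rightarrow> bool" where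
  "finite_infimizer F C Sp Sd \<longleftrightarrow>
     finite Sp \<and> Sp \<noteq> {} \<and> Sp \<subseteq> domain_of F \<and>
     finite Sd \<and> Sd \<subseteq> domain_of (recession_map F) - {0} \<and>
     upper_image F C \<subseteq>
       C + convex hull (\<Union>x\<in>Sp. F x) + convex_cone hull (\<Union>x\<in>Sd. recession_map F x)"

definition minimizing_point :: "('a \<Rightarrow> 'b::plus set) \<Rightarrow> 'b set \<Rightarrow> 'a \<Rightarrow> bool" where
  "minimizing_point F C x0 \<longleftrightarrow> x0 \<in> domain_of F \<and> \<not> (\<exists>x. F x + C \<supset> F x0 + C)"

definition minimizing_direction ::
  "('a::real_vector \<Rightarrow> 'b::real_vector set) \<Rightarrow> 'b set \<Rightarrow> 'a \<Rightarrow> bool" where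
  "minimizing_direction F C x0 \<longleftrightarrow>
     x0 \<noteq> 0 \<and> x0 \<in> domain_of (recession_map F) \<and>
     \<not> (\<exists>x. recession_map F x + C \<supset> recession_map F x0 + C)"

definition is_solution ::
  "('a::real_vector \<Rightarrow> 'b::real_vector set) \<Rightarrow> 'b set \<Rightarrow> 'a set \<Rightarrow> 'a set \<Rightarrow> bool" where
  "is_solution F C Sp Sd \<longleftrightarrow>
     finite_infimizer F C Sp Sd \<and>
     (\<forall>x\<in>Sp. minimizing_point F C x) \<and> (\<forall>x\<in>Sd. minimizing_direction F C x)"

section \<open>Ingredients of the algorithm\<close>

text \<open>A pair \<open>(w, \<gamma>)\<close> stands for the inequality \<open>w \<bullet> y \<le> \<gamma>\<close>.\<close>

definition inequality_rep :: "'b::real_inner set \<Rightarrow> ('b \<times> real) set \<Rightarrow> bool" where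
  "inequality_rep Q R \<longleftrightarrow>
     finite R \<and> (\<forall>(w, \<gamma>)\<in>R. norm w = 1) \<and> Q = {y. \<forall>(w, \<gamma>)\<in>R. w \<bullet> y \<le> \<gamma>}"

definition minimal_normals :: "'b::real_inner set \<Rightarrow> 'b set \<Rightarrow> bool" where
  "minimal_normals Q N \<longleftrightarrow>
     (\<exists>R. inequality_rep Q R \<and> (\<forall>R'. inequality_rep Q R' \<longrightarrow> card R \<le> card R') \<and> N = fst ` R)"

definition lp_feasible ::
  "('a \<Rightarrow> 'b::plus set) \<Rightarrow> 'b set \<Rightarrow> 'a \<Rightarrow> 'a \<times> 'b \<Rightarrow> bool" where
  "lp_feasible H C x0 = (\<lambda>(x, y). y \<in> H x + C \<and> H x0 + C \<subseteq> H x + C)"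

definition lp_optimal ::
  "('a \<Rightarrow> 'b::real_inner set) \<Rightarrow> 'b set \<Rightarrow> 'b \<Rightarrow> 'a \<Rightarrow> 'a \<times> 'b \<Rightarrow> bool" where
  "lp_optimal H C w x0 p \<longleftrightarrow>
     lp_feasible H C x0 p \<and> (\<forall>p'. lp_feasible H C x0 p' \<longrightarrow> w \<bullet> snd p' \<le> w \<bullet> snd p)"

definition V_representation :: "'b::real_vector set \<Rightarrow> 'b set \<Rightarrow> 'b set \<Rightarrow> bool" where
  "V_representation Q P R \<longleftrightarrow> finite P \<and> finite R \<and> Q = convex hull P + convex_cone hull R"

section \<open>The nondeterministic procedures as transition systems\<close>

text \<open>
  \<open>CM_Loop x N W\<close> is the state before a test of the loop condition \<open>N \<subseteq> W\<close>, where \<open>x\<close> is the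
  current candidate. A run is a sequence of steps, and the alternatives for a step are the arbitrary
  choices of the procedure.
\<close>

datatype ('a, 'b) cm_state =
    CM_Start 'b
  | CM_Loop 'a "'b set" "'b set"
  | CM_Return "'a set"

inductive cm_step ::
  "('a \<Rightarrow> 'b::real_inner set) \<Rightarrow> 'b set \<Rightarrow> ('a, 'b) cm_state \<Rightarrow> ('a, 'b) cm_state \<Rightarrow> bool"
  for H C where
  start: "y \<in> H x + C \<Longrightarrow> minimal_normals (H x + C) N \<Longrightarrow>
    cm_step H C (CM_Start y) (CM_Loop x N {})"
| no_optimum: "w \<in> N - W \<Longrightarrow> \<not> (\<exists>p. lp_optimal H C w x p) \<Longrightarrow>
    cm_step H C (CM_Loop x N W) (CM_Return {})"
| keep: "w \<in> N - W \<Longrightarrow> lp_optimal H C w x (x', y') \<Longrightarrow> y' \<in> H x + C \<Longrightarrow>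
    cm_step H C (CM_Loop x N W) (CM_Loop x N (insert w W))"
| improve: "w \<in> N - W \<Longrightarrow> lp_optimal H C w x (x', y') \<Longrightarrow> y' \<notin> H x + C \<Longrightarrow>
    minimal_normals (H x' + C) N' \<Longrightarrow>
    cm_step H C (CM_Loop x N W) (CM_Loop x' N' (insert w W))"
| finish: "N \<subseteq> W \<Longrightarrow>
    cm_step H C (CM_Loop x N W) (CM_Return {x})"

text \<open>
  \<open>Check s\<close>, \<open>Point_Call s P D Sp Sd\<close> and \<open>Direction_Call s D Sp Sd\<close> are states inside a call of the
  subprocedure that has reached \<open>s\<close>. In \<open>Points P D Sp Sd\<close> and \<open>Directions D Sp Sd\<close> the sets \<open>P\<close>
  and \<open>D\<close> hold the points and directions still to be processed, and \<open>Sp\<close> and \<open>Sd\<close> are the values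
  of the two output variables. A run of the algorithm starts in \<open>Init\<close>.
\<close>

datatype ('a, 'b) solve_state =
    Init
  | Check "('a, 'b) cm_state"
  | Points "'b set" "'b set" "'a set" "'a set"
  | Point_Call "('a, 'b) cm_state" "'b set" "'b set" "'a set" "'a set"
  | Directions "'b set" "'a set" "'a set"
  | Direction_Call "('a, 'b) cm_state" "'b set" "'a set" "'a set"
  | Output "'a set" "'a set"

inductive solve_step ::
  "('a::real_vector \<Rightarrow> 'b::real_inner set) \<Rightarrow> 'b set \<Rightarrow>
     ('a, 'b) solve_state \<Rightarrow> ('a, 'b) solve_state \<Rightarrow> bool"
  for F C where
  empty_image: "upper_image F C = {} \<Longrightarrow>
    solve_step F C Init (Output {} {})"
| check_start: "upper_image F C \<noteq> {} \<Longrightarrow>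
    solve_step F C Init (Check (CM_Start 0))"
| check_step: "cm_step (recession_map F) C s s' \<Longrightarrow>
    solve_step F C (Check s) (Check s')"
| check_fail: "solve_step F C (Check (CM_Return {})) (Output {} {})"
| check_succeed: "X \<noteq> {} \<Longrightarrow> V_representation (upper_image F C) P R \<Longrightarrow>
    solve_step F C (Check (CM_Return X)) (Points P (R - C) {} {})"
| point_start: "y \<in> P \<Longrightarrow>
    solve_step F C (Points P D Sp Sd) (Point_Call (CM_Start y) (P - {y}) D Sp Sd)"
| point_step: "cm_step F C s s' \<Longrightarrow>
    solve_step F C (Point_Call s P D Sp Sd) (Point_Call s' P D Sp Sd)"
| point_return:
    "solve_step F C (Point_Call (CM_Return X) P D Sp Sd) (Points P D (Sp \<union> X) Sd)"
| points_done: "solve_step F C (Points {} D Sp Sd) (Directions D Sp Sd)"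
| direction_start: "y \<in> D \<Longrightarrow>
    solve_step F C (Directions D Sp Sd) (Direction_Call (CM_Start y) (D - {y}) Sp Sd)"
| direction_step: "cm_step (recession_map F) C s s' \<Longrightarrow>
    solve_step F C (Direction_Call s D Sp Sd) (Direction_Call s' D Sp Sd)"
| direction_return:
    "solve_step F C (Direction_Call (CM_Return X) D Sp Sd) (Directions D Sp (Sd \<union> X))"
| directions_done: "solve_step F C (Directions {} Sp Sd) (Output Sp Sd)"

end

theory Submission
  imports Defs
begin

text \<open>
  Since \<open>G 0 = C\<close>, the set \<open>C\<close> is the recession cone of every nonempty value of \<open>F\<close> and of \<open>G\<close>, so
  adding \<open>C\<close> changes no value. Everything depends on whether there is an improving direction, that is
  some \<open>d\<close> with \<open>0 \<in> G d\<close> and some \<open>e \<in> G d - C\<close>. If there is one, then \<open>F (x + t *\<^sub>R d)\<close> contains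
  both \<open>F x\<close> and \<open>F x + t *\<^sub>R e\<close>, which excludes minimizing points of \<open>F\<close> and, by the same argument,
  of \<open>G\<close>. A linear program without optimal solution is unbounded along a ray, and this ray yields an
  improving direction. Hence the test call of the subprocedure fails exactly when an improving
  direction exists, in which case there is no solution, and no later call can fail when the test call
  succeeds.

  In the loop, processing a normal \<open>w\<close> makes the supremum of \<open>w\<close> on the current value as large as on any
  larger value, and this persists when the value grows. When all normals of the value have been
  processed, the value is maximal. The loop ends because the values are bounded by finitely many
  facet normals altogether.
\<close>

section \<open>Polyhedra\<close>

lemma polyhedron_inequalities:
  fixes S :: "'a::euclidean_space set"
  assumes "polyhedron S"
  obtains K where "finite K" "S = {x. \<forall>(a, b)\<in>K. a \<bullet> x \<le> b}"
proof -
  obtain F where F: "finite F" "S = \<Inter>F" "\<forall>h\<in>F. \<exists>a b. a \<noteq> 0 \<and> h = {x. a \<bullet> x \<le> b}"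
    using assms unfolding polyhedron_def by auto
  then obtain a b where ab: "\<And>h. h \<in> F \<Longrightarrow> h = {x. a h \<bullet> x \<le> b h}"
    by metis
  have "S = {x. \<forall>(a, b)\<in>(\<lambda>h. (a h, b h)) ` F. a \<bullet> x \<le> b}"
    using F(2) ab by auto
  with F(1) that show thesis
    by blast
qed

text \<open>A zero normal gives the empty set or the whole space, so inequality systems may contain
  zero normals without a case distinction.\<close>

lemma polyhedron_le: "polyhedron {x::'a::euclidean_space. a \<bullet> x \<le> b}"
  by (cases "a = 0") (auto simp: polyhedron_halfspace_le)

lemma polyhedron_from_inequalities:
  fixes K :: "('a::euclidean_space \<times> real) set"
  assumes "finite K"
  shows "polyhedron {x. \<forall>(a, b)\<in>K. a \<bullet> x \<le> b}"
proof -
  have "{x. \<forall>(a, b)\<in>K. a \<bullet> x \<le> b} = \<Inter>((\<lambda>(a, b). {x. a \<bullet> x \<le> b}) ` K)"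
    by auto
  also have "polyhedron \<dots>"
    using assms by (intro polyhedron_Inter) (auto simp: polyhedron_le)
  finally show ?thesis .
qed

section \<open>Rays and recession cones of polyhedra\<close>

lemma nonpos_if_ray_bounded:
  fixes u v b :: real
  assumes "\<And>t. t \<ge> 0 \<Longrightarrow> u + t * v \<le> b"
  shows "v \<le> 0"
proof (rule ccontr)
  assume "\<not> v \<le> 0"
  \<comment> \<open>This multiple makes the left side \<open>u + \<bar>b - u\<bar> + 1\<close>,
    which exceeds \<open>b\<close>.\<close>
  moreover have "u + (\<bar>b - u\<bar> + 1) / v * v \<le> b"
    using calculation by (intro assms) auto
  ultimately show False
    by auto
qed

text \<open>Along a ray each constraint is affine with slope \<open>a \<bullet> d\<close>, so
  staying below \<open>b\<close> forces a nonpositive slope, and this sign condition does not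
  mention the starting point. Hence a single ray from \<open>p\<close> decides membership. The point
  \<open>p\<close> also excludes the empty set, whose recession cone is the whole space.\<close>

lemma recession_cone_inequalities:
  fixes K :: "('a::euclidean_space \<times> real) set"
  assumes "p \<in> {x. \<forall>(a, b)\<in>K. a \<bullet> x \<le> b}"
  shows "recession_cone {x. \<forall>(a, b)\<in>K. a \<bullet> x \<le> b} = {d. \<forall>(a, b)\<in>K. a \<bullet> d \<le> 0}"
    and "(\<And>t. t \<ge> 0 \<Longrightarrow> p + t *\<^sub>R d \<in> {x. \<forall>(a, b)\<in>K. a \<bullet> x \<le> b}) \<Longrightarrow>
      d \<in> {d. \<forall>(a, b)\<in>K. a \<bullet> d \<le> 0}"
proof -
  show ray: "d \<in> {d. \<forall>(a, b)\<in>K. a \<bullet> d \<le> 0}"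
    if "\<And>t. t \<ge> 0 \<Longrightarrow> p + t *\<^sub>R d \<in> {x. \<forall>(a, b)\<in>K. a \<bullet> x \<le> b}" for d
  proof -
    have "a \<bullet> d \<le> 0" if "(a, b) \<in> K" for a b
    proof (rule nonpos_if_ray_bounded)
      fix t :: real
      assume "t \<ge> 0"
      then have "a \<bullet> (p + t *\<^sub>R d) \<le> b"
        using \<open>\<And>t. t \<ge> 0 \<Longrightarrow> _\<close> \<open>(a, b) \<in> K\<close> by fastforce
      then show "a \<bullet> p + t * (a \<bullet> d) \<le> b"
        by (simp add: inner_add_right)
    qed
    then show ?thesis
      by auto
  qed
  show "recession_cone {x. \<forall>(a, b)\<in>K. a \<bullet> x \<le> b} = {d. \<forall>(a, b)\<in>K. a \<bullet> d \<le> 0}"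
  proof
    show "recession_cone {x. \<forall>(a, b)\<in>K. a \<bullet> x \<le> b} \<subseteq> {d. \<forall>(a, b)\<in>K. a \<bullet> d \<le> 0}"
      using ray assms unfolding recession_cone_def by blast
    show "{d. \<forall>(a, b)\<in>K. a \<bullet> d \<le> 0} \<subseteq> recession_cone {x. \<forall>(a, b)\<in>K. a \<bullet> x \<le> b}"
    proof (clarsimp simp: recession_cone_def inner_add_right)
      fix d x :: 'a and t b :: real and a
      assume "\<forall>(a, b)\<in>K. a \<bullet> d \<le> 0" "\<forall>(a, b)\<in>K. a \<bullet> x \<le> b" "0 \<le> t" "(a, b) \<in> K"
      then have "a \<bullet> x \<le> b" "t * (a \<bullet> d) \<le> 0"
        by (auto simp: mult_nonneg_nonpos)
      then show "a \<bullet> x + t * (a \<bullet> d) \<le> b"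
        by simp
    qed
  qed
qed

text \<open>All later elements of \<open>G\<close> that come from geometric arguments are certified
  in this way, by one ray inside the graph.\<close>

lemma recession_cone_rayI:
  fixes S :: "'a::euclidean_space set"
  assumes "polyhedron S" "p \<in> S" "\<And>t. t \<ge> 0 \<Longrightarrow> p + t *\<^sub>R d \<in> S"
  shows "d \<in> recession_cone S"
proof -
  obtain K where K: "S = {x. \<forall>(a, b)\<in>K. a \<bullet> x \<le> b}"
    using assms(1) polyhedron_inequalities by blast
  show ?thesis
    using recession_cone_inequalities[of p K] assms(2,3) unfolding K by blast
qed

lemma polyhedron_recession_cone:
  fixes S :: "'a::euclidean_space set"
  assumes "polyhedron S"
  shows "polyhedron (recession_cone S)"
proof (cases "S = {}")
  case True
  then show ?thesis
    by (simp add: recession_cone_def)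
next
  case False
  obtain K where K: "finite K" "S = {x. \<forall>(a, b)\<in>K. a \<bullet> x \<le> b}"
    using assms polyhedron_inequalities by blast
  then have "recession_cone S = {d. \<forall>(a, b)\<in>K. a \<bullet> d \<le> 0}"
    using recession_cone_inequalities(1)[of _ K] False by blast
  also have "\<dots> = {d. \<forall>(a, b)\<in>(\<lambda>(a, b). (a, 0)) ` K. a \<bullet> d \<le> b}"
    by auto
  finally show ?thesis
    using K(1) polyhedron_from_inequalities[of "(\<lambda>(a, b). (a, 0)) ` K"] by auto
qed

lemma convex_cone_recession_cone: "convex_cone (recession_cone S)"
  unfolding convex_cone_iff
proof (intro conjI ballI allI impI)
  show "0 \<in> recession_cone S"
    by (simp add: recession_cone_def)
  show "x + y \<in> recession_cone S" if "x \<in> recession_cone S" "y \<in> recession_cone S" for x y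
    using that by (simp add: recession_cone_def scaleR_add_right flip: add.assoc)
  show "c *\<^sub>R x \<in> recession_cone S" if "x \<in> recession_cone S" "0 \<le> c" for x c
    using that by (simp add: recession_cone_def)
qed

text \<open>Testing at the point 0 with \<open>t = 1\<close> gives one inclusion, closure under sums
  and multiples the other. Applied to the graph of \<open>G\<close>, it makes \<open>G\<close> its
  own recession mapping.\<close>

lemma recession_cone_of_convex_cone:
  assumes "convex_cone K"
  shows "recession_cone K = K"
proof
  show "recession_cone K \<subseteq> K"
  proof
    fix d
    assume "d \<in> recession_cone K"
    then have "0 + 1 *\<^sub>R d \<in> K"
      using convex_cone_contains_0[OF assms] unfolding recession_cone_def
      by (smt (verit) mem_Collect_eq)
    then show "d \<in> K"
      by simp
  qed
  show "K \<subseteq> recession_cone K"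
    using assms by (auto simp: recession_cone_def convex_cone_iff)
qed

text \<open>
  The normals of the polyhedral cone generated by \<open>A\<close> generate the polar cone of \<open>A\<close>, by separation.
\<close>

lemma polar_cone_finitely_generated:
  fixes A :: "'a::euclidean_space set"
  assumes "finite A"
  obtains B where "finite B" "{x. \<forall>a\<in>A. a \<bullet> x \<le> 0} = convex_cone hull B"
proof -
  let ?K = "convex_cone hull A"
  have K: "polyhedron ?K" "convex_cone ?K"
    using assms by (auto simp: polyhedron_convex_cone_hull convex_cone_convex_cone_hull)
  obtain L where L: "finite L" "?K = {x. \<forall>(a, b)\<in>L. a \<bullet> x \<le> b}"
    using K(1) polyhedron_inequalities by blast
  have "0 \<in> ?K"
    by (simp add: convex_cone_hull_contains_0)
  \<comment> \<open>A convex cone equals its recession cone, so every right-hand side may be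
    replaced by 0.\<close>
  then have rep: "?K = {x. \<forall>(a, b)\<in>L. a \<bullet> x \<le> 0}"
    using recession_cone_inequalities(1)[of 0 L] recession_cone_of_convex_cone[OF K(2)] L(2) by simp
  define B where "B = fst ` L"
  have repB: "?K = {x. \<forall>b\<in>B. b \<bullet> x \<le> 0}"
    unfolding rep B_def by force
  have "{x. \<forall>a\<in>A. a \<bullet> x \<le> 0} \<subseteq> convex_cone hull B"
  proof (rule ccontr)
    assume "\<not> ?thesis"
    then obtain x where x: "\<forall>a\<in>A. a \<bullet> x \<le> 0" "x \<notin> convex_cone hull B"
      by auto
    have cl: "closed (convex_cone hull B)"
      using L(1) by (simp add: B_def closed_convex_cone_hull)
    obtain w \<gamma> where w: "w \<bullet> x < \<gamma>" "\<forall>y\<in>convex_cone hull B. w \<bullet> y > \<gamma>"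
      using separating_hyperplane_closed_point[OF convex_convex_cone_hull cl x(2)] by auto
    have "\<gamma> < 0"
      using w(2) convex_cone_hull_contains_0 by force
    \<comment> \<open>The hull contains all multiples \<open>t *\<^sub>R b\<close>, and
      \<open>w\<close> is bounded below on it, so \<open>w \<bullet> b\<close> cannot be
      negative.\<close>
    have "- w \<bullet> b \<le> 0" if "b \<in> B" for b
    proof (rule nonpos_if_ray_bounded[of 0 _ "- \<gamma>"])
      fix t :: real
      assume "t \<ge> 0"
      then have "t *\<^sub>R b \<in> convex_cone hull B"
        using that by (simp add: convex_cone_hull_mul hull_inc)
      then have "w \<bullet> (t *\<^sub>R b) > \<gamma>"
        using w(2) by blast
      then show "0 + t * (- w \<bullet> b) \<le> - \<gamma>"
        by simp
    qed
    \<comment> \<open>\<open>- w\<close> satisfies the inequalities of \<open>?K\<close>, while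
      \<open>x\<close> is nonpositive on the generators of \<open>?K\<close>. So
      \<open>w \<bullet> x\<close> is nonnegative, which contradicts the separation.\<close>
    then have "- w \<in> ?K"
      unfolding repB by (auto simp: inner_commute)
    moreover have "?K \<subseteq> {y. x \<bullet> y \<le> 0}"
      using x(1) by (intro hull_minimal convex_cone_halfspace_le) (auto simp: inner_commute)
    ultimately have "w \<bullet> x \<ge> 0"
      by (auto simp: inner_commute)
    then show False
      using w(1) \<open>\<gamma> < 0\<close> by simp
  qed
  moreover have "convex_cone hull B \<subseteq> {x. \<forall>a\<in>A. a \<bullet> x \<le> 0}"
  proof (rule hull_minimal)
    show "B \<subseteq> {x. \<forall>a\<in>A. a \<bullet> x \<le> 0}"
    proof clarify
      fix b a
      assume "b \<in> B" "a \<in> A"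
      then show "a \<bullet> b \<le> 0"
        using hull_inc[of a A convex_cone] unfolding repB by (auto simp: inner_commute[of a])
    qed
    show "convex_cone {x. \<forall>a\<in>A. a \<bullet> x \<le> 0}"
      by (auto simp: convex_cone_iff inner_add_right mult_nonneg_nonpos)
         (meson add_nonpos_nonpos)
  qed
  ultimately show thesis
    using that[of B] L(1) by (auto simp: B_def)
qed

text \<open>
  \<open>S\<close> is the slice at height 1 of the polyhedral cone of all \<open>(x, t)\<close> with \<open>t \<ge> 0\<close> and
  \<open>a \<bullet> x \<le> b * t\<close>. Its generators at positive height yield the points, those at height 0 the
  directions.
\<close>

lemma polyhedron_V_representation:
  fixes S :: "'a::euclidean_space set"
  assumes "polyhedron S"
  obtains P R where "V_representation S P R" "R \<subseteq> recession_cone S"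
proof -
  obtain K where K: "finite K" "S = {x. \<forall>(a, b)\<in>K. a \<bullet> x \<le> b}"
    using assms polyhedron_inequalities by blast
  \<comment> \<open>The vector \<open>(0, -1)\<close> encodes \<open>t \<ge> 0\<close>, and
    \<open>(a, - b)\<close> encodes \<open>a \<bullet> x \<le> b * t\<close>.\<close>
  define A where "A = insert (0, -1) ((\<lambda>(a, b). (a, - b)) ` K)"
  have "finite A"
    using K(1) by (simp add: A_def)
  then obtain B where B: "finite B" "{z. \<forall>a\<in>A. a \<bullet> z \<le> 0} = convex_cone hull B"
    using polar_cone_finitely_generated by blast
  have polar: "(x, t) \<in> convex_cone hull B \<longleftrightarrow> t \<ge> 0 \<and> (\<forall>(a, b)\<in>K. a \<bullet> x \<le> b * t)" for x t
    by (subst B(2)[symmetric]) (auto simp: A_def)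
  define P where "P = (\<lambda>z. fst z /\<^sub>R snd z) ` {z \<in> B. snd z > 0}"
  define R where "R = fst ` {z \<in> B. snd z = 0}"
  have fin: "finite P" "finite R"
    using B(1) by (auto simp: P_def R_def)
  have "P \<subseteq> S"
  proof
    fix p
    assume "p \<in> P"
    then obtain x t where xt: "(x, t) \<in> B" "t > 0" "p = x /\<^sub>R t"
      by (auto simp: P_def)
    then have "\<forall>(a, b)\<in>K. a \<bullet> x \<le> b * t"
      using polar hull_inc by metis
    then show "p \<in> S"
      using xt by (auto simp: K(2) field_simps)
  qed
  have R: "R \<subseteq> recession_cone S"
  proof
    fix r
    assume "r \<in> R"
    then have "(r, 0) \<in> B"
      by (auto simp: R_def)
    then have "\<forall>(a, b)\<in>K. a \<bullet> r \<le> b * 0"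
      using polar hull_inc by metis
    then have "r \<in> {d. \<forall>(a, b)\<in>K. a \<bullet> d \<le> 0}"
      by simp
    \<comment> \<open>For empty \<open>S\<close> the recession cone is everything, so the inclusion
      is trivial there.\<close>
    moreover have "S = {} \<or> recession_cone S = {d. \<forall>(a, b)\<in>K. a \<bullet> d \<le> 0}"
      using recession_cone_inequalities(1)[of _ K] unfolding K(2) by blast
    ultimately show "r \<in> recession_cone S"
      by (elim disjE) (simp add: recession_cone_def, blast)
  qed
  have "S = convex hull P + convex_cone hull R"
  proof
    show "convex hull P + convex_cone hull R \<subseteq> S"
    proof
      fix x
      assume "x \<in> convex hull P + convex_cone hull R"
      then obtain p r where pr: "x = p + r" "p \<in> convex hull P" "r \<in> convex_cone hull R"
        by (auto elim: set_plus_elim)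
      have "p \<in> S"
        using pr(2) \<open>P \<subseteq> S\<close> polyhedron_imp_convex[OF assms] hull_minimal by blast
      moreover have "r \<in> recession_cone S"
        using pr(3) R convex_cone_recession_cone[of S] hull_minimal by blast
      ultimately have "p + 1 *\<^sub>R r \<in> S"
        unfolding recession_cone_def by (smt (verit) mem_Collect_eq)
      then show "x \<in> S"
        by (simp add: pr(1))
    qed
    show "S \<subseteq> convex hull P + convex_cone hull R"
    proof
      fix x
      assume "x \<in> S"
      then have "(x, 1) \<in> convex_cone hull B"
        by (auto simp: polar K(2))
      \<comment> \<open>Each generator is a nonnegative multiple of one at height 1 or 0.\<close>
      moreover have "convex_cone hull B \<subseteq> convex_cone hull (P \<times> {1} \<union> (\<lambda>r. (r, 0)) ` R)"
        (is "_ \<subseteq> convex_cone hull ?B'")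
      proof (rule hull_minimal)
        show "convex_cone (convex_cone hull ?B')"
          by (rule convex_cone_convex_cone_hull)
        show "B \<subseteq> convex_cone hull ?B'"
        proof
          fix z
          assume z: "z \<in> B"
          then have "snd z \<ge> 0"
            using polar[of "fst z" "snd z"] hull_inc[of z B convex_cone] by simp
          then consider "snd z > 0" | "snd z = 0"
            by linarith
          then show "z \<in> convex_cone hull ?B'"
          proof cases
            case 1
            then have "(fst z /\<^sub>R snd z, 1) \<in> convex_cone hull ?B'"
              using z by (intro hull_inc) (auto simp: P_def)
            then have "snd z *\<^sub>R (fst z /\<^sub>R snd z, 1) \<in> convex_cone hull ?B'"
              using 1 by (intro convex_cone_hull_mul) auto
            then show ?thesis
              using 1 by (cases z) simp
          next
            case 2
            then have "z = (fst z, 0)"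
              by (simp add: prod_eq_iff)
            then show ?thesis
              using z 2 by (intro hull_inc) (auto simp: R_def)
          qed
        qed
      qed
      \<comment> \<open>\<open>v\<close> has height 0, so \<open>u\<close> has height 1. At that
        height the cone over \<open>P \<times> {1}\<close> is just
        \<open>convex hull P\<close>.\<close>
      ultimately obtain u v where uv: "(x, 1::real) = u + v" "u \<in> convex_cone hull (P \<times> {1})"
        "v \<in> convex_cone hull ((\<lambda>r. (r, 0)) ` R)"
        unfolding convex_cone_hull_Un by blast
      have "linear (\<lambda>r::'a. (r, 0::real))"
        by (auto intro!: linearI)
      then obtain r where r: "v = (r, 0)" "r \<in> convex_cone hull R"
        using uv(3) by (auto simp: convex_cone_hull_linear_image)
      have u1: "snd u = 1"
        using uv(1) r(1) by (metis add.right_neutral snd_add snd_conv)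
      then obtain c p where cp: "c \<ge> 0" "p \<in> convex hull P" "u = c *\<^sub>R (p, 1)"
        using uv(2) by (auto simp: convex_cone_hull_convex_hull convex_hull_Times)
      then have "u = (p, 1)"
        using u1 by simp
      then have "x = p + r"
        using uv(1) r(1) by simp
      then show "x \<in> convex hull P + convex_cone hull R"
        using cp(2) r(2) by auto
    qed
  qed
  then show thesis
    using that[of P R] fin R by (simp add: V_representation_def)
qed

text \<open>Linear maps commute with Minkowski sums, convex hulls and conic hulls. The intended map
  is the projection of a graph onto its second component.\<close>

lemma V_representation_linear_image:
  assumes "linear f" "V_representation S P R"
  shows "V_representation (f ` S) (f ` P) (f ` R)"
proof -
  have add: "f ` (A + B) = f ` A + f ` B" for A B
  proof
    show "f ` (A + B) \<subseteq> f ` A + f ` B"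
      by (auto elim!: set_plus_elim simp: linear_add[OF assms(1)] intro!: set_plus_intro imageI)
    show "f ` A + f ` B \<subseteq> f ` (A + B)"
      by (auto elim!: set_plus_elim simp flip: linear_add[OF assms(1)])
  qed
  have "S = convex hull P + convex_cone hull R"
    using assms(2) by (simp add: V_representation_def)
  then have "f ` S = f ` (convex hull P) + f ` (convex_cone hull R)"
    by (simp only: add)
  also have "\<dots> = convex hull (f ` P) + convex_cone hull (f ` R)"
    by (simp only: convex_hull_linear_image[OF assms(1)] convex_cone_hull_linear_image[OF assms(1)])
  finally show ?thesis
    using assms(2) by (simp add: V_representation_def)
qed

text \<open>In a V-representation, if no generating direction increases \<open>w\<close>, then the
  largest value of \<open>w\<close> on the finitely many points is an attained maximum over
  \<open>S\<close>. So a missing optimum singles out a generating direction that increases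
  \<open>w\<close>.\<close>

lemma linear_program_unbounded_direction:
  fixes S :: "'a::euclidean_space set"
  assumes "polyhedron S" "S \<noteq> {}" "\<not> (\<exists>p\<in>S. \<forall>p'\<in>S. w \<bullet> p' \<le> w \<bullet> p)"
  obtains d where "d \<in> recession_cone S" "w \<bullet> d > 0"
proof -
  obtain P R where PR: "V_representation S P R" "R \<subseteq> recession_cone S"
    using assms(1) polyhedron_V_representation by blast
  have S: "S = convex hull P + convex_cone hull R" "finite P"
    using PR(1) by (auto simp: V_representation_def)
  then have "P \<noteq> {}"
    using assms(2) by auto
  have "\<not> (\<forall>r\<in>R. w \<bullet> r \<le> 0)"
  proof
    assume "\<forall>r\<in>R. w \<bullet> r \<le> 0"
    then have R: "convex_cone hull R \<subseteq> {r. w \<bullet> r \<le> 0}"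
      by (intro hull_minimal) (auto simp: convex_cone_halfspace_le)
    define m where "m = Max ((\<bullet>) w ` P)"
    obtain p where p: "p \<in> P" "w \<bullet> p = m"
      using Max_in[of "(\<bullet>) w ` P"] S(2) \<open>P \<noteq> {}\<close> unfolding m_def by fastforce
    have P: "convex hull P \<subseteq> {p. w \<bullet> p \<le> m}"
      using S(2) by (intro hull_minimal) (auto simp: m_def convex_halfspace_le)
    have "p + 0 \<in> S"
      unfolding S(1) using p by (intro set_plus_intro) (auto simp: hull_inc convex_cone_hull_contains_0)
    moreover have "w \<bullet> p' \<le> w \<bullet> p" if p': "p' \<in> S" for p'
    proof -
      obtain a r where "p' = a + r" "a \<in> convex hull P" "r \<in> convex_cone hull R"
        using p' unfolding S(1) by (auto elim: set_plus_elim)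
      then show ?thesis
        using P R p(2) by (fastforce simp: inner_add_right)
    qed
    ultimately show False
      using assms(3) by auto
  qed
  then show thesis
    using that PR(2) by force
qed

section \<open>Minimal systems of normals\<close>

lemma minimal_normals_exist:
  assumes "inequality_rep Q R"
  obtains N where "minimal_normals Q N"
proof -
  obtain R' where "inequality_rep Q R'" "\<forall>R''. inequality_rep Q R'' \<longrightarrow> card R' \<le> card R''"
    using ex_has_least_nat[of "inequality_rep Q" R card] assms by auto
  with that show thesis
    unfolding minimal_normals_def by blast
qed

text \<open>
  Removing an inequality \<open>w \<bullet> x \<le> \<gamma>\<close> from a minimal representation enlarges the set, so the segment
  from an interior point to one of the new points leaves \<open>Q\<close> through the relative interior of the
  facet of \<open>w\<close>. There \<open>Q\<close> is locally a halfspace with outer normal \<open>w\<close>, which forces \<open>w\<close> to occur in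
  every representation.
\<close>

lemma minimal_normals_subset:
  fixes Q :: "'a::euclidean_space set"
  assumes "minimal_normals Q N" "interior Q \<noteq> {}" "inequality_rep Q R0"
  shows "N \<subseteq> fst ` R0"
proof
  fix w
  assume "w \<in> N"
  then obtain R \<gamma> where R: "inequality_rep Q R" "\<And>R'. inequality_rep Q R' \<Longrightarrow> card R \<le> card R'"
    and w: "(w, \<gamma>) \<in> R"
    using assms(1) unfolding minimal_normals_def by force
  have finR: "finite R" and normR: "\<And>u \<delta>. (u, \<delta>) \<in> R \<Longrightarrow> norm u = 1"
    and Q: "Q = {y. \<forall>(u, \<delta>)\<in>R. u \<bullet> y \<le> \<delta>}"
    using R(1) by (auto simp: inequality_rep_def)
  have finR0: "finite R0" and normR0: "\<And>u \<delta>. (u, \<delta>) \<in> R0 \<Longrightarrow> norm u = 1"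
    and Q0: "Q = {y. \<forall>(u, \<delta>)\<in>R0. u \<bullet> y \<le> \<delta>}"
    using assms(3) by (auto simp: inequality_rep_def)
  let ?R' = "R - {(w, \<gamma>)}"
  have "\<not> inequality_rep Q ?R'"
    using R(2)[of ?R'] card_Diff1_less[OF finR w] by auto
  then have "Q \<noteq> {y. \<forall>(u, \<delta>)\<in>?R'. u \<bullet> y \<le> \<delta>}"
    using finR normR by (auto simp: inequality_rep_def)
  moreover have "Q \<subseteq> {y. \<forall>(u, \<delta>)\<in>?R'. u \<bullet> y \<le> \<delta>}"
    unfolding Q by blast
  ultimately obtain y0 where y0: "\<And>u \<delta>. (u, \<delta>) \<in> ?R' \<Longrightarrow> u \<bullet> y0 \<le> \<delta>" "y0 \<notin> Q"
    by blast
  have wy0: "w \<bullet> y0 > \<gamma>"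
  proof (rule ccontr)
    assume "\<not> w \<bullet> y0 > \<gamma>"
    then have "u \<bullet> y0 \<le> \<delta>" if "(u, \<delta>) \<in> R" for u \<delta>
      using y0(1)[of u \<delta>] that by (cases "(u, \<delta>) = (w, \<gamma>)") auto
    then show False
      using y0(2) unfolding Q by blast
  qed
  obtain z where z: "z \<in> interior Q"
    using assms(2) by blast
  have strict: "u \<bullet> z < \<delta>" if u: "(u, \<delta>) \<in> R" for u \<delta>
  proof -
    have "Q \<subseteq> {y. u \<bullet> y \<le> \<delta>}"
      using u unfolding Q by blast
    then have "z \<in> interior {y. u \<bullet> y \<le> \<delta>}"
      using z interior_mono by blast
    moreover have "u \<noteq> 0"
      using normR[OF u] by auto
    ultimately show ?thesis
      by (simp add: interior_halfspace_le)
  qed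
  \<comment> \<open>The parameter at which the segment from \<open>z\<close> to \<open>y0\<close>
    meets the hyperplane \<open>w \<bullet> y = \<gamma>\<close>. Since \<open>s < 1\<close>, the
    interior point \<open>z\<close> keeps positive weight, which makes the other inequalities strict
    at \<open>p\<close>.\<close>
  define s where "s = (\<gamma> - w \<bullet> z) / (w \<bullet> y0 - w \<bullet> z)"
  have s: "0 < s" "s < 1"
    using strict[OF w] wy0 by (auto simp: s_def)
  define p where "p = z + s *\<^sub>R (y0 - z)"
  have wp: "w \<bullet> p = \<gamma>"
    using strict[OF w] wy0 by (simp add: p_def s_def inner_add_right inner_diff_right)
  have others: "u \<bullet> p < \<delta>" if u: "(u, \<delta>) \<in> ?R'" for u \<delta>
  proof -
    have "u \<bullet> p = (1 - s) * (u \<bullet> z) + s * (u \<bullet> y0)"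
      by (simp add: p_def algebra_simps inner_add_right inner_diff_right)
    also have "\<dots> < (1 - s) * \<delta> + s * \<delta>"
      using strict[of u \<delta>] y0(1)[OF u] u s by (intro add_less_le_mono) auto
    finally show ?thesis
      by (simp add: algebra_simps)
  qed
  have "p \<in> Q"
    using others wp unfolding Q by (force intro: less_imp_le)
  have "open {y. \<forall>(u, \<delta>)\<in>?R'. u \<bullet> y < \<delta>}"
  proof -
    have "{y. \<forall>(u, \<delta>)\<in>?R'. u \<bullet> y < \<delta>} = (\<Inter>(u, \<delta>)\<in>?R'. {y. u \<bullet> y < \<delta>})"
      by auto
    then show ?thesis
      using finR by (auto intro!: open_INT simp: open_halfspace_lt)
  qed
  moreover have "p \<in> {y. \<forall>(u, \<delta>)\<in>?R'. u \<bullet> y < \<delta>}"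
    using others by auto
  ultimately obtain \<epsilon> where \<epsilon>: "\<epsilon> > 0" "cball p \<epsilon> \<subseteq> {y. \<forall>(u, \<delta>)\<in>?R'. u \<bullet> y < \<delta>}"
    using open_contains_cball by blast
  \<comment> \<open>Only the inequality of \<open>w\<close> is active at \<open>p\<close>, so short
    steps in any direction of its halfspace stay in \<open>Q\<close>.\<close>
  have local: "\<exists>t>0. p + t *\<^sub>R v \<in> Q" if v: "w \<bullet> v \<le> 0" for v
  proof -
    define t where "t = \<epsilon> / (norm v + 1)"
    have t: "t > 0" "t * norm v \<le> \<epsilon>"
      using \<epsilon>(1) by (auto simp: t_def field_simps add_pos_nonneg)
    have "p + t *\<^sub>R v \<in> cball p \<epsilon>"
      using t by (simp add: dist_norm)
    then have "u \<bullet> (p + t *\<^sub>R v) < \<delta>" if "(u, \<delta>) \<in> ?R'" for u \<delta>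
      using \<epsilon>(2) that by blast
    moreover have "w \<bullet> (p + t *\<^sub>R v) \<le> \<gamma>"
      using v t(1) wp by (simp add: inner_add_right mult_nonneg_nonpos)
    ultimately have "u \<bullet> (p + t *\<^sub>R v) \<le> \<delta>" if "(u, \<delta>) \<in> R" for u \<delta>
      using that by (cases "(u, \<delta>) = (w, \<gamma>)") (auto intro: less_imp_le)
    then show ?thesis
      using t(1) unfolding Q by blast
  qed
  \<comment> \<open>If all inequalities of \<open>R0\<close> were strict at \<open>p\<close>, then
    \<open>p\<close> would be interior to \<open>Q\<close>, but it lies on the bounding hyperplane
    of \<open>w\<close>.\<close>
  have "\<exists>(u, \<delta>)\<in>R0. \<delta> \<le> u \<bullet> p"
  proof (rule ccontr)
    assume "\<not> ?thesis"
    then have "p \<in> (\<Inter>(u, \<delta>)\<in>R0. {y. u \<bullet> y < \<delta>})"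
      by force
    moreover have "open (\<Inter>(u, \<delta>)\<in>R0. {y. u \<bullet> y < \<delta>})"
      using finR0 by (auto intro!: open_INT simp: open_halfspace_lt)
    moreover have "(\<Inter>(u, \<delta>)\<in>R0. {y. u \<bullet> y < \<delta>}) \<subseteq> Q"
      unfolding Q0 by (force intro: less_imp_le)
    ultimately have "p \<in> interior Q"
      using interior_maximal by blast
    moreover have "Q \<subseteq> {y. w \<bullet> y \<le> \<gamma>}"
      using w unfolding Q by blast
    ultimately have "p \<in> interior {y. w \<bullet> y \<le> \<gamma>}"
      using interior_mono by blast
    moreover have "w \<noteq> 0"
      using normR[OF w] by auto
    ultimately show False
      using wp by (simp add: interior_halfspace_le)
  qed
  then obtain u \<delta> where u: "(u, \<delta>) \<in> R0" "\<delta> \<le> u \<bullet> p"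
    by blast
  have half: "u \<bullet> v \<le> 0" if v: "w \<bullet> v \<le> 0" for v
  proof -
    obtain t where t: "t > 0" "p + t *\<^sub>R v \<in> Q"
      using local[OF v] by blast
    then have "u \<bullet> (p + t *\<^sub>R v) \<le> \<delta>"
      using u(1) unfolding Q0 by blast
    then have "t * (u \<bullet> v) \<le> 0"
      using u(2) by (simp add: inner_add_right)
    then show ?thesis
      using t(1) by (simp add: mult_le_0_iff)
  qed
  have unit: "w \<bullet> w = 1" "u \<bullet> u = 1"
    using normR[OF w] normR0[OF u(1)] by (auto simp: norm_eq_1)
  \<comment> \<open>Testing \<open>half\<close> with the component of \<open>u\<close> orthogonal to
    \<open>w\<close> shows that \<open>w \<bullet> u\<close> has square at least 1. Testing it with
    \<open>- w\<close> fixes the sign, and unit vectors with inner product at least 1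
    coincide.\<close>
  have "u \<bullet> (u - (w \<bullet> u) *\<^sub>R w) \<le> 0"
    using unit by (intro half) (simp add: inner_diff_right)
  then have "1 \<le> (w \<bullet> u)\<^sup>2"
    using unit by (simp add: inner_diff_right inner_commute power2_eq_square)
  moreover have "w \<bullet> u \<ge> 0"
    using half[of "- w"] unit by (simp add: inner_commute)
  ultimately have "w \<bullet> u \<ge> 1"
    using power2_le_imp_le[of 1 "w \<bullet> u"] by simp
  then have "(w - u) \<bullet> (w - u) \<le> 0"
    using unit by (simp add: inner_diff_left inner_diff_right inner_commute)
  then have "w = u"
    using inner_ge_zero[of "w - u"] by (simp add: antisym)
  then show "w \<in> fst ` R0"
    using u(1) by force
qed

section \<open>Normals of the values of a polyhedral convex mapping\<close>

lemma polyhedral_convex_inequalities: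
  fixes H :: "'a::euclidean_space \<Rightarrow> 'b::euclidean_space set"
  assumes "polyhedral_convex H"
  obtains K where "finite K"
    "\<And>x y. y \<in> H x \<longleftrightarrow> (\<forall>(a, b)\<in>K. fst a \<bullet> x + snd a \<bullet> y \<le> b)"
proof -
  obtain K where K: "finite K" "graph_of H = {z. \<forall>(a, b)\<in>K. a \<bullet> z \<le> b}"
    by (rule polyhedron_inequalities[OF assms[unfolded polyhedral_convex_def]])
  have "y \<in> H x \<longleftrightarrow> (\<forall>(a, b)\<in>K. fst a \<bullet> x + snd a \<bullet> y \<le> b)" for x y
  proof -
    have "y \<in> H x \<longleftrightarrow> (x, y) \<in> graph_of H"
      by (simp add: graph_of_def)
    then show ?thesis
      unfolding K(2) by (simp add: inner_prod_def)
  qed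
  then show thesis
    by (rule that[OF K(1)])
qed

text \<open>Fixing \<open>x\<close> only moves \<open>fst a \<bullet> x\<close> to the right-hand
  side, so all values share the normals \<open>snd a\<close>, scaled to unit length by
  \<open>sgn\<close>. That \<open>B\<close> does not depend on \<open>x\<close> is what bounds the
  number of loop iterations.\<close>

lemma polyhedral_convex_normals:
  fixes H :: "'a::euclidean_space \<Rightarrow> 'b::euclidean_space set"
  assumes "polyhedral_convex H"
  obtains B where "finite B"
    "\<And>x. H x \<noteq> {} \<Longrightarrow> \<exists>R. inequality_rep (H x) R \<and> fst ` R \<subseteq> B"
proof -
  obtain K where K: "finite K"
    and H: "\<And>x y. y \<in> H x \<longleftrightarrow> (\<forall>(a, b)\<in>K. fst a \<bullet> x + snd a \<bullet> y \<le> b)"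
    using polyhedral_convex_inequalities[OF assms] by blast
  define K' where "K' = {(a, b) \<in> K. snd a \<noteq> 0}"
  define B where "B = (\<lambda>(a, b). sgn (snd a)) ` K'"
  have "K' \<subseteq> K"
    by (auto simp: K'_def)
  then have finK': "finite K'"
    using K finite_subset by blast
  have "\<exists>R. inequality_rep (H x) R \<and> fst ` R \<subseteq> B" if x: "H x \<noteq> {}" for x
  proof -
    define R where "R = (\<lambda>(a, b). (sgn (snd a), (b - fst a \<bullet> x) / norm (snd a))) ` K'"
    have scale: "sgn (snd a) \<bullet> y \<le> (b - fst a \<bullet> x) / norm (snd a) \<longleftrightarrow> fst a \<bullet> x + snd a \<bullet> y \<le> b"
      if "(a, b) \<in> K'" for a b y
      using that by (auto simp: K'_def sgn_div_norm field_simps)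
    obtain y0 where y0: "y0 \<in> H x"
      using x by blast
    have "y \<in> H x \<longleftrightarrow> (\<forall>(u, \<delta>)\<in>R. u \<bullet> y \<le> \<delta>)" for y
    proof -
      have "y \<in> H x \<longleftrightarrow> (\<forall>(a, b)\<in>K'. fst a \<bullet> x + snd a \<bullet> y \<le> b)"
        using y0 unfolding H K'_def by fastforce
      also have "\<dots> \<longleftrightarrow> (\<forall>(u, \<delta>)\<in>R. u \<bullet> y \<le> \<delta>)"
        unfolding R_def using scale by fastforce
      finally show ?thesis .
    qed
    then have "H x = {y. \<forall>(u, \<delta>)\<in>R. u \<bullet> y \<le> \<delta>}"
      by blast
    moreover have "finite R" "\<forall>(u, \<delta>)\<in>R. norm u = 1"
      using finK' by (auto simp: R_def K'_def norm_sgn)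
    ultimately have "inequality_rep (H x) R"
      unfolding inequality_rep_def by blast
    moreover have "fst ` R \<subseteq> B"
      by (force simp: R_def B_def)
    ultimately show ?thesis
      by blast
  qed
  moreover have "finite B"
    using finK' by (simp add: B_def)
  ultimately show thesis
    using that by blast
qed

section \<open>Improving directions\<close>

text \<open>The predicate refers only to \<open>G\<close> and \<open>C\<close>, so calls for
  \<open>F\<close> and calls for \<open>G\<close> meet the same obstacle.\<close>

definition improving_direction ::
  "('a \<Rightarrow> 'b::zero set) \<Rightarrow> 'b set \<Rightarrow> 'a \<Rightarrow> 'b \<Rightarrow> bool" where
  "improving_direction G C d e \<longleftrightarrow> e \<in> G d \<and> 0 \<in> G d \<and> e \<notin> C"

text \<open>Used twice, with \<open>H\<close> being \<open>F\<close> and with \<open>H\<close> being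
  \<open>G\<close>, so each fact about the subprocedure is proved once.\<close>

locale polyhedral_mapping =
  fixes H :: "'a::euclidean_space \<Rightarrow> 'b::euclidean_space set" and G C
  assumes polyhedral: "polyhedral_convex H"
    and recession: "recession_map H = G"
    and G_0: "G 0 = C"
    and interior_C: "interior C \<noteq> {}"
begin

lemma G_iff: "e \<in> G d \<longleftrightarrow> (d, e) \<in> recession_cone (graph_of H)"
  by (simp add: recession_map_def flip: recession)

lemma ray: "y \<in> H x \<Longrightarrow> e \<in> G d \<Longrightarrow> t \<ge> 0 \<Longrightarrow> y + t *\<^sub>R e \<in> H (x + t *\<^sub>R d)"
  by (force simp: G_iff recession_cone_def graph_of_def)

lemma rayI:
  assumes "y \<in> H x" "\<And>t. t \<ge> 0 \<Longrightarrow> y + t *\<^sub>R e \<in> H (x + t *\<^sub>R d)"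
  shows "e \<in> G d"
  using recession_cone_rayI[of "graph_of H" "(x, y)" "(d, e)"] assms polyhedral
  by (simp add: G_iff graph_of_def polyhedral_convex_def)

lemma convex_cone_graph_G: "convex_cone (graph_of G)"
proof -
  have "graph_of G = recession_cone (graph_of H)"
    by (auto simp: graph_of_def G_iff)
  then show ?thesis
    by (simp add: convex_cone_recession_cone)
qed

lemma G_scale: "e \<in> G d \<Longrightarrow> c \<ge> 0 \<Longrightarrow> c *\<^sub>R e \<in> G (c *\<^sub>R d)"
  using convex_cone_scaleR[OF convex_cone_graph_G, of c "(d, e)"] by (simp add: graph_of_def)

lemma convex_cone_C: "convex_cone C"
proof -
  have "0 \<in> C"
    using convex_cone_contains_0[OF convex_cone_graph_G] by (simp add: graph_of_def zero_prod_def G_0)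
  moreover have "x + y \<in> C" if "x \<in> C" "y \<in> C" for x y
    using convex_cone_add[OF convex_cone_graph_G, of "(0, x)" "(0, y)"] that
    by (simp add: graph_of_def G_0)
  moreover have "c *\<^sub>R x \<in> C" if "x \<in> C" "c \<ge> 0" for x c
    using G_scale[of x 0 c] that by (simp add: G_0)
  ultimately show ?thesis
    by (simp add: convex_cone_iff)
qed

lemma ray_C: "y \<in> H x \<Longrightarrow> c \<in> C \<Longrightarrow> t \<ge> 0 \<Longrightarrow> y + t *\<^sub>R c \<in> H x"
  using ray[of y x c 0 t] by (simp add: G_0)

lemma H_plus_C: "H x + C = H x"
proof
  show "H x + C \<subseteq> H x"
  proof
    fix z
    assume "z \<in> H x + C"
    then obtain y c where "z = y + c" "y \<in> H x" "c \<in> C"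
      by (auto elim: set_plus_elim)
    then show "z \<in> H x"
      using ray_C[of y x c 1] by simp
  qed
  show "H x \<subseteq> H x + C"
    using set_zero_plus2[of C "H x"] convex_cone_contains_0[OF convex_cone_C]
    by (simp add: add.commute)
qed

lemma upper_image_eq: "upper_image H C = (\<Union>x. H x)"
proof
  show "upper_image H C \<subseteq> (\<Union>x. H x)"
  proof
    fix z
    assume "z \<in> upper_image H C"
    then obtain c y x where "z = c + y" "c \<in> C" "y \<in> H x"
      by (auto simp: upper_image_def elim!: set_plus_elim)
    then show "z \<in> (\<Union>x. H x)"
      using ray_C[of y x c 1] by (auto simp: add.commute)
  qed
  show "(\<Union>x. H x) \<subseteq> upper_image H C"
    unfolding upper_image_def
    using set_zero_plus2[of C] convex_cone_contains_0[OF convex_cone_C] by blast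
qed

lemma minimizing_point_iff:
  "minimizing_point H C x \<longleftrightarrow> H x \<noteq> {} \<and> (\<forall>x'. H x \<subseteq> H x' \<longrightarrow> H x' = H x)"
  unfolding minimizing_point_def H_plus_C domain_of_def by blast

text \<open>A nonempty value contains a translate of \<open>C\<close>. The interior is needed for
  \<open>minimal_normals_subset\<close>.\<close>

lemma interior_H: "H x \<noteq> {} \<Longrightarrow> interior (H x) \<noteq> {}"
proof -
  assume "H x \<noteq> {}"
  then obtain y where y: "y \<in> H x"
    by blast
  have "(+) y ` C \<subseteq> H x"
    using ray_C[OF y, of _ 1] by auto
  then have "interior ((+) y ` C) \<subseteq> interior (H x)"
    by (rule interior_mono)
  then show "interior (H x) \<noteq> {}"
    using interior_C by (auto simp: interior_translation)
qed

text \<open>Minimality turns \<open>H x \<subseteq> H (x + t *\<^sub>R d)\<close> into an equality,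
  so the ray from \<open>y\<close> along \<open>e\<close> stays in \<open>H x\<close>. This puts
  \<open>e\<close> into \<open>G 0\<close>, which is \<open>C\<close>.\<close>

lemma no_minimizing_point_if_improving_direction:
  assumes "improving_direction G C d e"
  shows "\<not> minimizing_point H C x"
proof
  assume min: "minimizing_point H C x"
  then obtain y where y: "y \<in> H x"
    by (auto simp: minimizing_point_iff)
  have "y + t *\<^sub>R e \<in> H x" if t: "t \<ge> 0" for t
  proof -
    have "H x \<subseteq> H (x + t *\<^sub>R d)"
      using ray[of _ x 0 d t] assms t by (auto simp: improving_direction_def)
    then have "H (x + t *\<^sub>R d) = H x"
      using min by (auto simp: minimizing_point_iff)
    then show ?thesis
      using ray[OF y, of e d t] assms t by (auto simp: improving_direction_def)
  qed
  then have "e \<in> G 0"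
    using rayI[OF y, of e 0] by simp
  then show False
    using assms by (simp add: G_0 improving_direction_def)
qed

text \<open>The inclusion \<open>H x0 \<subseteq> H x\<close> splits into one condition on
  \<open>x\<close> for each inequality of the graph: that inequality with
  \<open>snd a \<bullet> y\<close> replaced by its supremum over \<open>H x0\<close>. An infinite
  supremum makes the condition unsatisfiable.\<close>

lemma polyhedron_lp_feasible:
  assumes "H x0 \<noteq> {}"
  shows "polyhedron {p. lp_feasible H C x0 p}"
proof -
  obtain K where K: "finite K"
    and H: "\<And>x y. y \<in> H x \<longleftrightarrow> (\<forall>(a, b)\<in>K. fst a \<bullet> x + snd a \<bullet> y \<le> b)"
    using polyhedral_convex_inequalities[OF polyhedral] by blast
  define L where "L = (\<lambda>(a, b). {p::'a \<times> 'b. \<forall>y\<in>H x0. fst a \<bullet> fst p + snd a \<bullet> y \<le> b})"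
  have "polyhedron (L (a, b))" for a b
  proof (cases "L (a, b) = {}")
    case False
    then obtain q where "q \<in> L (a, b)"
      by blast
    then have q: "fst a \<bullet> fst q + snd a \<bullet> y \<le> b" if "y \<in> H x0" for y
      using that by (simp add: L_def)
    \<comment> \<open>A single feasible \<open>q\<close> bounds \<open>snd a\<close> on
      \<open>H x0\<close>, so the supremum is a genuine one.\<close>
    have bdd: "bdd_above ((\<bullet>) (snd a) ` H x0)"
      using q by (auto intro!: bdd_aboveI[of _ "b - fst a \<bullet> fst q"] simp: le_diff_eq add.commute)
    have "p \<in> L (a, b) \<longleftrightarrow> (fst a, 0) \<bullet> p \<le> b - (SUP y\<in>H x0. snd a \<bullet> y)" for p
    proof -
      have "p \<in> L (a, b) \<longleftrightarrow> (\<forall>y\<in>H x0. snd a \<bullet> y \<le> b - fst a \<bullet> fst p)"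
        by (auto simp: L_def algebra_simps)
      also have "\<dots> \<longleftrightarrow> (SUP y\<in>H x0. snd a \<bullet> y) \<le> b - fst a \<bullet> fst p"
        using cSUP_le_iff[OF assms bdd] by simp
      finally show ?thesis
        by (auto simp: inner_prod_def)
    qed
    then have "L (a, b) = {p. (fst a, 0) \<bullet> p \<le> b - (SUP y\<in>H x0. snd a \<bullet> y)}"
      by blast
    then show ?thesis
      by (simp only: polyhedron_le)
  qed simp
  then have "polyhedron (\<Inter>(L ` K))"
    using K by (intro polyhedron_Inter) auto
  moreover have "polyhedron (graph_of H)"
    using polyhedral by (simp add: polyhedral_convex_def)
  moreover have "{p. lp_feasible H C x0 p} = graph_of H \<inter> \<Inter>(L ` K)"
  proof -
    have "H x0 \<subseteq> H x \<longleftrightarrow> (x, y) \<in> \<Inter>(L ` K)" for x y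
    proof -
      have "H x0 \<subseteq> H x \<longleftrightarrow> (\<forall>y\<in>H x0. \<forall>(a, b)\<in>K. fst a \<bullet> x + snd a \<bullet> y \<le> b)"
        using H[of _ x] by blast
      also have "\<dots> \<longleftrightarrow> (x, y) \<in> \<Inter>(L ` K)"
        by (simp add: L_def case_prod_unfold) blast
      finally show ?thesis .
    qed
    then show ?thesis
      by (auto simp: lp_feasible_def H_plus_C graph_of_def)
  qed
  ultimately show ?thesis
    by auto
qed

text \<open>Along the ray of unboundedness both \<open>y + t *\<^sub>R e\<close> and
  \<open>y\<close> belong to \<open>H (x + t *\<^sub>R d)\<close>, hence \<open>e\<close> and 0
  belong to \<open>G d\<close>. As a normal of the value, \<open>w\<close> is bounded above on
  \<open>H x\<close>; since \<open>w\<close> grows along \<open>e\<close>, the vector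
  \<open>e\<close> cannot lie in \<open>C\<close>.\<close>

lemma improving_direction_if_no_optimum:
  assumes "H x \<noteq> {}" "minimal_normals (H x + C) N" "w \<in> N" "\<nexists>p. lp_optimal H C w x p"
  shows "\<exists>d e. improving_direction G C d e"
proof -
  let ?S = "{p. lp_feasible H C x p}"
  obtain y where y: "y \<in> H x"
    using assms(1) by blast
  have feasible: "lp_feasible H C x (x, y)"
    using y by (simp add: lp_feasible_def H_plus_C)
  have "\<not> (\<exists>p\<in>?S. \<forall>p'\<in>?S. (0, w) \<bullet> p' \<le> (0, w) \<bullet> p)"
    using assms(4) by (auto simp: lp_optimal_def inner_prod_def)
  then obtain d' where "d' \<in> recession_cone ?S" "(0, w) \<bullet> d' > 0"
    using linear_program_unbounded_direction[OF polyhedron_lp_feasible[OF assms(1)], of "(0, w)"]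
      feasible by blast
  then obtain d e where de: "(d, e) \<in> recession_cone ?S" "w \<bullet> e > 0"
    by (cases d') (simp add: inner_prod_def)
  have "lp_feasible H C x (x + t *\<^sub>R d, y + t *\<^sub>R e)" if "t \<ge> 0" for t
    using de(1) feasible that by (force simp: recession_cone_def)
  then have *: "y + t *\<^sub>R e \<in> H (x + t *\<^sub>R d)" "H x \<subseteq> H (x + t *\<^sub>R d)" if "t \<ge> 0" for t
    using that by (auto simp: lp_feasible_def H_plus_C)
  have "e \<in> G d"
    using rayI[OF y] * by blast
  moreover have "0 \<in> G d"
    using rayI[OF y, of 0 d] * y by auto
  moreover have "e \<notin> C"
  proof
    assume "e \<in> C"
    obtain \<gamma> where \<gamma>: "\<And>z. z \<in> H x \<Longrightarrow> w \<bullet> z \<le> \<gamma>"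
      using assms(2,3) unfolding H_plus_C minimal_normals_def inequality_rep_def by force
    have "w \<bullet> y + t * (w \<bullet> e) \<le> \<gamma>" if "t \<ge> 0" for t
      using \<gamma>[OF ray_C[OF y \<open>e \<in> C\<close> that]] by (simp add: inner_add_right)
    then have "w \<bullet> e \<le> 0"
      by (rule nonpos_if_ray_bounded)
    then show False
      using de(2) by simp
  qed
  ultimately show ?thesis
    by (auto simp: improving_direction_def)
qed

text \<open>
  Maximizing \<open>t\<close> subject to \<open>p + t *\<^sub>R y \<in> H x\<close> is an unbounded linear program in \<open>(x, t)\<close>, and a
  direction of unboundedness, scaled to \<open>t\<close>-component 1, is the required point.
\<close>

lemma ray_of_upper_image:
  assumes "p \<in> upper_image H C" "\<And>t. t \<ge> 0 \<Longrightarrow> p + t *\<^sub>R y \<in> upper_image H C"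
  obtains x where "y \<in> G x"
proof -
  obtain K where K: "finite K"
    and H: "\<And>x y. y \<in> H x \<longleftrightarrow> (\<forall>(a, b)\<in>K. fst a \<bullet> x + snd a \<bullet> y \<le> b)"
    using polyhedral_convex_inequalities[OF polyhedral] by blast
  define T where "T = {z::'a \<times> real. p + snd z *\<^sub>R y \<in> H (fst z)}"
  have T: "T = {z. \<forall>(a, b)\<in>(\<lambda>(a, b). ((fst a, snd a \<bullet> y), b - snd a \<bullet> p)) ` K. a \<bullet> z \<le> b}"
  proof -
    have "z \<in> T \<longleftrightarrow> (\<forall>(a, b)\<in>(\<lambda>(a, b). ((fst a, snd a \<bullet> y), b - snd a \<bullet> p)) ` K. a \<bullet> z \<le> b)" for z
    proof -
      have "z \<in> T \<longleftrightarrow> (\<forall>k\<in>K. fst (fst k) \<bullet> fst z + snd (fst k) \<bullet> (p + snd z *\<^sub>R y) \<le> snd k)"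
        by (simp add: T_def H case_prod_unfold)
      also have "\<dots> \<longleftrightarrow> (\<forall>k\<in>K. (fst (fst k), snd (fst k) \<bullet> y) \<bullet> z \<le> snd k - snd (fst k) \<bullet> p)"
        by (simp add: inner_prod_def inner_add_right algebra_simps)
      finally show ?thesis
        by (simp add: case_prod_unfold)
    qed
    then show ?thesis
      by blast
  qed
  have polyT: "polyhedron T"
    unfolding T using K by (intro polyhedron_from_inequalities) simp
  have reach: "\<exists>x. (x, t) \<in> T" if "t \<ge> 0" for t
    using assms(2)[OF that] by (auto simp: T_def upper_image_eq)
  then obtain x0 where x0: "(x0, 0) \<in> T"
    by blast
  \<comment> \<open>The objective \<open>(0, 1)\<close> reads off \<open>t\<close>, and every
    \<open>t \<ge> 0\<close> is reached.\<close>
  have "\<not> (\<exists>q\<in>T. \<forall>q'\<in>T. (0, 1) \<bullet> q' \<le> (0, 1) \<bullet> q)"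
  proof
    assume "\<exists>q\<in>T. \<forall>q'\<in>T. (0, 1) \<bullet> q' \<le> (0, 1) \<bullet> q"
    then obtain q where "\<forall>q'\<in>T. snd q' \<le> snd q"
      by (auto simp: inner_prod_def)
    moreover obtain x where "(x, \<bar>snd q\<bar> + 1) \<in> T"
      using reach[of "\<bar>snd q\<bar> + 1"] by auto
    ultimately show False
      by fastforce
  qed
  then obtain d' where "d' \<in> recession_cone T" "(0, 1) \<bullet> d' > 0"
    using linear_program_unbounded_direction[OF polyT, of "(0, 1)"] x0 by blast
  then obtain d \<tau> where d: "(d, \<tau>) \<in> recession_cone T" "\<tau> > 0"
    by (cases d') (simp add: inner_prod_def)
  have "\<tau> *\<^sub>R y \<in> G d"
  proof (rule rayI)
    show "p \<in> H x0"
      using x0 by (simp add: T_def)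
    show "p + t *\<^sub>R \<tau> *\<^sub>R y \<in> H (x0 + t *\<^sub>R d)" if "t \<ge> 0" for t
    proof -
      have "(x0, 0) + t *\<^sub>R (d, \<tau>) \<in> T"
        using d(1) x0 that unfolding recession_cone_def by blast
      then show ?thesis
        by (simp add: T_def)
    qed
  qed
  then have "inverse \<tau> *\<^sub>R \<tau> *\<^sub>R y \<in> G (inverse \<tau> *\<^sub>R d)"
    using d(2) by (intro G_scale) auto
  then show thesis
    using d(2) that by simp
qed

end

section \<open>Total correctness\<close>

text \<open>The accessible part of the converse step relation, with \<open>Q\<close> demanded
  wherever no step is possible. Induction on it covers all nondeterministic choices at once and
  gives termination and correctness together.\<close>

inductive totally_correct :: "('s \<Rightarrow> 's \<Rightarrow> bool) \<Rightarrow> ('s \<Rightarrow> bool) \<Rightarrow> 's \<Rightarrow> bool"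
  for step Q where
  totally_correctI: "(\<And>s'. step s s' \<Longrightarrow> totally_correct step Q s') \<Longrightarrow>
    ((\<forall>s'. \<not> step s s') \<Longrightarrow> Q s) \<Longrightarrow> totally_correct step Q s"

lemma totally_correct_no_infinite_run:
  assumes "totally_correct step Q (s 0)"
  shows "\<not> (\<forall>i. step (s i) (s (Suc i)))"
proof -
  \<comment> \<open>The run is generalized because the induction hypothesis is applied to its
    tail.\<close>
  have "\<not> (\<forall>i. step (r i) (r (Suc i)))" if "totally_correct step Q x" "r 0 = x" for r x
    using that
  proof (induction arbitrary: r)
    case (totally_correctI x)
    show ?case
    proof
      assume run: "\<forall>i. step (r i) (r (Suc i))"
      then have "step x (r 1)"
        using totally_correctI.prems by (metis One_nat_def)
      then have "\<not> (\<forall>i. step (r (Suc i)) (r (Suc (Suc i))))"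
        by (rule totally_correctI.IH(1)) simp
      then show False
        using run by blast
    qed
  qed
  then show ?thesis
    using assms by blast
qed

lemma totally_correct_final:
  fixes step :: "'s \<Rightarrow> 's \<Rightarrow> bool"
  assumes "step\<^sup>*\<^sup>* s t" "totally_correct step Q s" "\<forall>s'. \<not> step t s'"
  shows "Q t"
  using assms
proof (induction rule: converse_rtranclp_induct)
  case base
  from base(1) show ?case
    by cases (use base(2) in blast)
next
  case (step s s')
  from step.prems(1) have "totally_correct step Q s'"
    by cases (use step.hyps(1) in blast)
  then show ?case
    using step.IH step.prems(2) by blast
qed

text \<open>The specification of a call. A successful call must remember \<open>y \<in> H x\<close>,
  because the infimizer property is assembled from these memberships.\<close>

definition cm_result :: "('a \<Rightarrow> 'b::monoid_add set) \<Rightarrow> ('a \<Rightarrow> 'b set) \<Rightarrow> 'b set \<Rightarrow> 'b \<Rightarrow> 'a set \<Rightarrow> bool" where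
  "cm_result H G C y X \<longleftrightarrow>
     X = {} \<and> (\<exists>d e. improving_direction G C d e) \<or>
     (\<exists>x. X = {x} \<and> minimizing_point H C x \<and> y \<in> H x)"

section \<open>Termination and correctness of the subprocedure\<close>

context polyhedral_mapping
begin

lemma minimal_normals_ex:
  assumes "H x \<noteq> {}"
  obtains N where "minimal_normals (H x + C) N"
proof -
  obtain R where "inequality_rep (H x) R"
    using polyhedral_convex_normals[OF polyhedral] assms by metis
  then show thesis
    using minimal_normals_exist that unfolding H_plus_C by blast
qed

lemma lp_feasible_iff: "lp_feasible H C x (x', y') \<longleftrightarrow> y' \<in> H x' \<and> H x \<subseteq> H x'"
  by (simp add: lp_feasible_def H_plus_C)

text \<open>A comparison of the suprema of \<open>w\<close>, phrased by domination so that it makes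
  sense for unbounded \<open>w\<close> as well.\<close>

definition exhausted :: "'b \<Rightarrow> 'a \<Rightarrow> bool" where
  "exhausted w x \<longleftrightarrow> (\<forall>x'. H x \<subseteq> H x' \<longrightarrow> (\<forall>y'\<in>H x'. \<exists>y\<in>H x. w \<bullet> y' \<le> w \<bullet> y))"

text \<open>Values above \<open>H x'\<close> also lie above \<open>H x\<close>. Therefore
  \<open>W\<close> keeps its meaning when the candidate is replaced.\<close>

lemma exhausted_mono:
  assumes "exhausted w x" "H x \<subseteq> H x'"
  shows "exhausted w x'"
  using assms unfolding exhausted_def by (meson order.trans subsetD)

text \<open>Any value above \<open>H x'\<close> also contains \<open>H x\<close>, so its points
  compete in the program posed at \<open>x\<close> and are dominated by \<open>y'\<close>.\<close>

lemma exhausted_optimum: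
  assumes "lp_optimal H C w x (x', y')"
  shows "exhausted w x'"
  unfolding exhausted_def
proof (intro allI impI ballI)
  fix x'' y''
  assume "H x' \<subseteq> H x''" "y'' \<in> H x''"
  then have "lp_feasible H C x (x'', y'')" "y' \<in> H x'"
    using assms by (auto simp: lp_optimal_def lp_feasible_iff)
  then show "\<exists>y\<in>H x'. w \<bullet> y'' \<le> w \<bullet> y"
    using assms by (force simp: lp_optimal_def)
qed

lemma exhausted_keep:
  assumes "lp_optimal H C w x (x', y')" "y' \<in> H x"
  shows "exhausted w x"
  unfolding exhausted_def
proof (intro allI impI ballI)
  fix x'' y''
  assume "H x \<subseteq> H x''" "y'' \<in> H x''"
  then have "lp_feasible H C x (x'', y'')"
    by (auto simp: lp_feasible_iff)
  then show "\<exists>y\<in>H x. w \<bullet> y'' \<le> w \<bullet> y"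
    using assms by (force simp: lp_optimal_def)
qed

text \<open>Each facet inequality of \<open>H x\<close> passes to a larger value, because the normal
  takes no greater values there. The larger value thus satisfies the whole representation of
  \<open>H x\<close>.\<close>

lemma minimizing_point_if_exhausted:
  assumes "H x \<noteq> {}" "minimal_normals (H x + C) N" "\<And>w. w \<in> N \<Longrightarrow> exhausted w x"
  shows "minimizing_point H C x"
  unfolding minimizing_point_iff
proof (intro conjI allI impI)
  fix x'
  assume sub: "H x \<subseteq> H x'"
  obtain R where R: "inequality_rep (H x) R" "N = fst ` R"
    using assms(2) unfolding minimal_normals_def H_plus_C by blast
  then have H: "H x = {y. \<forall>(w, \<gamma>)\<in>R. w \<bullet> y \<le> \<gamma>}"
    by (simp add: inequality_rep_def)
  have "w \<bullet> y' \<le> \<gamma>" if y': "y' \<in> H x'" and w: "(w, \<gamma>) \<in> R" for y' w \<gamma>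
  proof -
    have "exhausted w x"
      using w R(2) by (intro assms(3)) force
    then obtain y where "y \<in> H x" "w \<bullet> y' \<le> w \<bullet> y"
      using sub y' unfolding exhausted_def by blast
    moreover have "w \<bullet> y \<le> \<gamma>"
      using \<open>y \<in> H x\<close> w unfolding H by blast
    ultimately show ?thesis
      by simp
  qed
  then have "H x' \<subseteq> H x"
    by (subst H) blast
  then show "H x' = H x"
    using sub by blast
qed (rule assms(1))

lemma totally_correct_CM_Return:
  "cm_result H G C y X \<Longrightarrow>
    totally_correct (cm_step H C) (\<lambda>s. \<exists>X. s = CM_Return X \<and> cm_result H G C y X) (CM_Return X)"
  by (rule totally_correctI) (auto elim: cm_step.cases)

text \<open>The invariant is that \<open>y\<close> stays in the current value, \<open>N\<close>
  belongs to that value and all of \<open>W\<close> is exhausted. Since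
  \<open>N \<subseteq> B\<close> throughout, each continuing iteration moves an element of
  \<open>B\<close> into \<open>W\<close>, and \<open>card (B - W)\<close> decreases.\<close>

lemma totally_correct_CM_Loop:
  assumes B: "finite B" "\<And>x. H x \<noteq> {} \<Longrightarrow> \<exists>R. inequality_rep (H x) R \<and> fst ` R \<subseteq> B"
    and "y \<in> H x" "minimal_normals (H x + C) N" "\<And>w. w \<in> W \<Longrightarrow> exhausted w x"
  shows "totally_correct (cm_step H C)
    (\<lambda>s. \<exists>X. s = CM_Return X \<and> cm_result H G C y X) (CM_Loop x N W)"
  using assms(3-5)
proof (induction "card (B - W)" arbitrary: x N W rule: less_induct)
  case less
  have x: "H x \<noteq> {}"
    using less.prems(1) by blast
  have "N \<subseteq> B"
    using minimal_normals_subset[of "H x" N] interior_H[OF x] B(2)[OF x] less.prems(2)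
    unfolding H_plus_C by blast
  then have smaller: "card (B - insert w W) < card (B - W)" if "w \<in> N - W" for w
    using that B(1) by (intro psubset_card_mono) auto
  show ?case
  proof (rule totally_correctI)
    fix s'
    assume "cm_step H C (CM_Loop x N W) s'"
    then show "totally_correct (cm_step H C)
      (\<lambda>s. \<exists>X. s = CM_Return X \<and> cm_result H G C y X) s'"
    proof cases
      case (no_optimum w)
      then have "cm_result H G C y {}"
        using improving_direction_if_no_optimum[OF x less.prems(2), of w]
        by (simp add: cm_result_def)
      then show ?thesis
        unfolding no_optimum(1) by (rule totally_correct_CM_Return)
    next
      case (keep w x' y')
      have "exhausted w x"
        using exhausted_keep keep(3,4) by (simp add: H_plus_C)
      then have "exhausted v x" if "v \<in> insert w W" for v
        using less.prems(3) that by blast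
      then show ?thesis
        unfolding keep(1) by (intro less.hyps smaller keep(2) less.prems(1,2))
    next
      case (improve w x' y' N')
      have sub: "H x \<subseteq> H x'"
        using improve(3) by (simp add: lp_optimal_def lp_feasible_iff)
      have "exhausted v x'" if "v \<in> insert w W" for v
        using exhausted_optimum[OF improve(3)] exhausted_mono[OF _ sub] less.prems(3) that by blast
      moreover have "y \<in> H x'"
        using less.prems(1) sub by blast
      ultimately show ?thesis
        unfolding improve(1) by (intro less.hyps smaller improve(2,5))
    next
      case finish
      then have "minimizing_point H C x"
        using minimizing_point_if_exhausted[OF x less.prems(2)] less.prems(3) by blast
      then have "cm_result H G C y {x}"
        using less.prems(1) by (simp add: cm_result_def)
      then show ?thesis
        unfolding finish(1) by (rule totally_correct_CM_Return)
    qed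
  next
    assume stuck: "\<forall>s'. \<not> cm_step H C (CM_Loop x N W) s'"
    \<comment> \<open>There is no deadlock: if \<open>finish\<close> does not apply and an optimum
      exists, either \<open>keep\<close> applies or the new value has a minimal system and
      \<open>improve\<close> applies.\<close>
    have False
    proof (cases "N \<subseteq> W")
      case True
      then show False
        using stuck cm_step.finish[OF True, of H C x] by blast
    next
      case False
      then obtain w where w: "w \<in> N - W"
        by blast
      then obtain x' y' where opt: "lp_optimal H C w x (x', y')"
        using stuck cm_step.no_optimum[OF w, of H C x] by (metis surj_pair)
      then have "H x' \<noteq> {}"
        by (auto simp: lp_optimal_def lp_feasible_iff)
      then obtain N' where "minimal_normals (H x' + C) N'"
        using minimal_normals_ex by blast
      then show False
        using stuck cm_step.keep[OF w opt] cm_step.improve[OF w opt] by blast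
    qed
    then show "\<exists>X. CM_Loop x N W = CM_Return X \<and> cm_result H G C y X" ..
  qed
qed

lemma totally_correct_CM_Start:
  assumes "y \<in> H x"
  shows "totally_correct (cm_step H C)
    (\<lambda>s. \<exists>X. s = CM_Return X \<and> cm_result H G C y X) (CM_Start y)"
proof (rule totally_correctI)
  obtain B where B: "finite B" "\<And>x. H x \<noteq> {} \<Longrightarrow> \<exists>R. inequality_rep (H x) R \<and> fst ` R \<subseteq> B"
    using polyhedral_convex_normals[OF polyhedral] by blast
  fix s'
  assume "cm_step H C (CM_Start y) s'"
  then show "totally_correct (cm_step H C)
    (\<lambda>s. \<exists>X. s = CM_Return X \<and> cm_result H G C y X) s'"
  proof cases
    case (start x N)
    then show ?thesis
      unfolding start(1)
      using totally_correct_CM_Loop[OF B start(2)[unfolded H_plus_C] start(3), of "{}"] by simp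
  qed
next
  assume stuck: "\<forall>s'. \<not> cm_step H C (CM_Start y) s'"
  obtain N where "minimal_normals (H x + C) N"
    using minimal_normals_ex assms by blast
  then have False
    using stuck cm_step.start[of y H x C N] assms by (simp add: H_plus_C)
  then show "\<exists>X. CM_Start y = CM_Return X \<and> cm_result H G C y X" ..
qed

end

text \<open>The rule for subprocedure calls. In a state \<open>f s\<close> the outer system imitates
  \<open>sub\<close>, and it can act otherwise only when \<open>sub\<close> is stuck. Then
  \<open>P\<close> holds, some outer step exists, and every such step leads to a totally correct
  state.\<close>

lemma totally_correct_embed:
  assumes "totally_correct sub P s"
    and "\<And>s s'. sub s s' \<Longrightarrow> step (f s) (f s')"
    and "\<And>s t. step (f s) t \<Longrightarrow> (\<exists>s'. sub s s' \<and> t = f s') \<or> (\<forall>s'. \<not> sub s s')"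
    and "\<And>s. P s \<Longrightarrow> \<exists>t. step (f s) t"
    and "\<And>s t. P s \<Longrightarrow> step (f s) t \<Longrightarrow> totally_correct step Q t"
  shows "totally_correct step Q (f s)"
  using assms(1)
proof induction
  case (totally_correctI s)
  show ?case
  proof (rule totally_correct.totally_correctI)
    fix t
    assume t: "step (f s) t"
    show "totally_correct step Q t"
    proof (cases "\<forall>s'. \<not> sub s s'")
      case True
      then show ?thesis
        using totally_correctI.hyps assms(5) t by blast
    next
      case False
      then obtain s' where "sub s s'" "t = f s'"
        using assms(3)[OF t] by blast
      then show ?thesis
        using totally_correctI.IH by blast
    qed
  next
    assume stuck: "\<forall>t. \<not> step (f s) t"
    then have "\<forall>s'. \<not> sub s s'"
      using assms(2) by blast
    then show "Q (f s)"
      using totally_correctI.hyps assms(4) stuck by blast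
  qed
qed

lemma not_cm_step_CM_Return: "\<not> cm_step H C (CM_Return X) s"
  by (auto elim: cm_step.cases)

lemma totally_correct_Output: "Q (Output Sp Sd) \<Longrightarrow> totally_correct (solve_step F C) Q (Output Sp Sd)"
  by (rule totally_correctI) (auto elim: solve_step.cases)

section \<open>Termination and correctness of the algorithm\<close>

context polyhedral_mapping
begin

lemma polyhedral_mapping_recession: "polyhedral_mapping G G C"
proof
  have graph_G: "graph_of G = recession_cone (graph_of H)"
    by (auto simp: graph_of_def G_iff)
  then show "polyhedral_convex G"
    using polyhedral by (simp add: polyhedral_convex_def polyhedron_recession_cone)
  show "recession_map G = G"
    using recession_cone_of_convex_cone[OF convex_cone_graph_G]
    by (auto simp: recession_map_def graph_of_def)
qed (rule G_0, rule interior_C)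

lemma minimizing_direction_iff: "minimizing_direction H C x \<longleftrightarrow> x \<noteq> 0 \<and> minimizing_point G C x"
  by (simp add: minimizing_direction_def minimizing_point_def recession)

text \<open>Both hulls are monotone, so it is enough to cover the generators of the upper image.
  Directions in \<open>C\<close> need no element of \<open>Sd\<close>, since the summand
  \<open>C\<close> absorbs them.\<close>

lemma is_solution_if_covering:
  assumes V: "V_representation (upper_image H C) P R" and ne: "upper_image H C \<noteq> {}"
    and Sp: "finite Sp" "\<And>x. x \<in> Sp \<Longrightarrow> minimizing_point H C x" "\<And>y. y \<in> P \<Longrightarrow> \<exists>x\<in>Sp. y \<in> H x"
    and Sd: "finite Sd" "\<And>x. x \<in> Sd \<Longrightarrow> minimizing_direction H C x"
      "\<And>y. y \<in> R - C \<Longrightarrow> \<exists>x\<in>Sd. y \<in> G x"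
  shows "is_solution H C Sp Sd"
proof -
  have eq: "upper_image H C = convex hull P + convex_cone hull R"
    using V by (simp add: V_representation_def)
  then have "P \<noteq> {}"
    using ne by auto
  then have "Sp \<noteq> {}"
    using Sp(3) by blast
  have "upper_image H C \<subseteq> C + convex hull (\<Union>x\<in>Sp. H x) + convex_cone hull (\<Union>x\<in>Sd. G x)"
  proof
    fix z
    assume "z \<in> upper_image H C"
    then obtain p r where z: "z = p + r" "p \<in> convex hull P" "r \<in> convex_cone hull R"
      unfolding eq by (auto elim: set_plus_elim)
    have "convex hull P \<subseteq> convex hull (\<Union>x\<in>Sp. H x)"
      using Sp(3) by (intro hull_mono) blast
    then have p: "p \<in> convex hull (\<Union>x\<in>Sp. H x)"
      using z(2) by blast
    have "convex_cone hull R \<subseteq> convex_cone hull (C \<union> (\<Union>x\<in>Sd. G x))"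
      using Sd(3) by (intro hull_mono) blast
    moreover have "convex_cone hull C = C"
      by (rule hull_same[of convex_cone]) (rule convex_cone_C)
    ultimately obtain c g where cg: "r = c + g" "c \<in> C" "g \<in> convex_cone hull (\<Union>x\<in>Sd. G x)"
      using z(3) unfolding convex_cone_hull_Un by auto
    have "z = c + p + g"
      using z(1) cg(1) by (simp add: algebra_simps)
    then show "z \<in> C + convex hull (\<Union>x\<in>Sp. H x) + convex_cone hull (\<Union>x\<in>Sd. G x)"
      using p cg(2,3) by (simp add: set_plus_intro)
  qed
  moreover have "Sp \<subseteq> domain_of H"
    using Sp(2) by (auto simp: minimizing_point_def)
  moreover have "Sd \<subseteq> domain_of G - {0}"
    using Sd(2) by (auto simp: minimizing_direction_def recession)
  ultimately have "finite_infimizer H C Sp Sd"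
    using Sp(1) Sd(1) \<open>Sp \<noteq> {}\<close> by (simp add: finite_infimizer_def recession)
  then show ?thesis
    using Sp(2) Sd(2) by (simp add: is_solution_def)
qed

text \<open>A solution has a nonempty \<open>Sp\<close>, whose elements would be minimizing
  points.\<close>

lemma no_solution_if_improving_direction:
  assumes "improving_direction G C d e"
  shows "\<not> is_solution H C Sp Sd"
  using no_minimizing_point_if_improving_direction[OF assms]
  by (auto simp: is_solution_def finite_infimizer_def)

lemma no_solution_if_empty_upper_image:
  assumes "upper_image H C = {}"
  shows "\<not> is_solution H C Sp Sd"
  using assms by (auto simp: upper_image_eq is_solution_def finite_infimizer_def domain_of_def)

text \<open>The last premise is a continuation: it quantifies over every \<open>Sd'\<close> with
  which the loop may end, as the calls choose their results freely.\<close>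

lemma totally_correct_Directions:
  assumes no_improving: "\<nexists>d e. improving_direction G C d e"
    and "finite D" "\<And>y. y \<in> D \<Longrightarrow> y \<notin> C \<and> (\<exists>x. y \<in> G x)"
    and "finite Sd" "\<And>x. x \<in> Sd \<Longrightarrow> minimizing_direction H C x"
    and "\<And>Sd'. finite Sd' \<Longrightarrow> Sd \<subseteq> Sd' \<Longrightarrow> (\<And>x. x \<in> Sd' \<Longrightarrow> minimizing_direction H C x) \<Longrightarrow>
      (\<And>y. y \<in> D \<Longrightarrow> \<exists>x\<in>Sd'. y \<in> G x) \<Longrightarrow> Q (Output Sp Sd')"
  shows "totally_correct (solve_step H C) Q (Directions D Sp Sd)"
  using assms(2-)
proof (induction "card D" arbitrary: D Sd rule: less_induct)
  case less
  interpret G: polyhedral_mapping G G C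
    by (rule polyhedral_mapping_recession)
  show ?case
  proof (rule totally_correctI)
    fix t
    assume "solve_step H C (Directions D Sp Sd) t"
    then show "totally_correct (solve_step H C) Q t"
    proof cases
      case (direction_start y)
      let ?call = "\<lambda>s. Direction_Call s (D - {y}) Sp Sd"
      obtain x where "y \<in> G x"
        using less.prems(2) direction_start(2) by blast
      then have "totally_correct (cm_step G C)
        (\<lambda>s. \<exists>X. s = CM_Return X \<and> cm_result G G C y X) (CM_Start y)"
        by (rule G.totally_correct_CM_Start)
      then show ?thesis
        unfolding direction_start(1)
      proof (rule totally_correct_embed[where f = ?call])
        show "solve_step H C (?call s) (?call s')" if "cm_step G C s s'" for s s'
          using that by (simp add: solve_step.direction_step recession)
        show "(\<exists>s'. cm_step G C s s' \<and> t = ?call s') \<or> (\<forall>s'. \<not> cm_step G C s s')"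
          if "solve_step H C (?call s) t" for s t
          using that by cases (auto simp: recession not_cm_step_CM_Return)
        show "\<exists>t. solve_step H C (?call s) t"
          if "\<exists>X. s = CM_Return X \<and> cm_result G G C y X" for s
          using that by (auto intro: solve_step.direction_return)
        show "totally_correct (solve_step H C) Q t"
          if result: "\<exists>X. s = CM_Return X \<and> cm_result G G C y X" and t: "solve_step H C (?call s) t"
          for s t
        proof -
          \<comment> \<open>An empty result would carry an improving direction.\<close>
          obtain x where x: "s = CM_Return {x}" "minimizing_point G C x" "y \<in> G x"
            using result no_improving by (auto simp: cm_result_def)
          \<comment> \<open>\<open>y\<close> lies in \<open>G x\<close> but not in \<open>C\<close>,
            which is \<open>G 0\<close>.\<close>
          then have "x \<noteq> 0"
            using less.prems(2) direction_start(2) G_0 by blast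
          then have min: "minimizing_direction H C x"
            using x(2) by (simp add: minimizing_direction_iff)
          have "t = Directions (D - {y}) Sp (Sd \<union> {x})"
            using t unfolding x(1) by cases (auto simp: not_cm_step_CM_Return)
          moreover have "totally_correct (solve_step H C) Q (Directions (D - {y}) Sp (Sd \<union> {x}))"
          proof (rule less.hyps)
            show "card (D - {y}) < card D"
              using less.prems(1) direction_start(2) by (rule card_Diff1_less)
            fix Sd'
            assume "finite Sd'" "Sd \<union> {x} \<subseteq> Sd'"
              "\<And>x. x \<in> Sd' \<Longrightarrow> minimizing_direction H C x"
              "\<And>y'. y' \<in> D - {y} \<Longrightarrow> \<exists>x\<in>Sd'. y' \<in> G x"
            then show "Q (Output Sp Sd')"
              using x(3) by (intro less.prems(5)) blast+
          qed (use less.prems(1-4) min in auto)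
          ultimately show ?thesis
            by simp
        qed
      qed
    next
      case directions_done
      then show ?thesis
        unfolding directions_done(2)
        by (intro totally_correct_Output less.prems(5)) (use less.prems(3,4) in auto)
    qed
  next
    assume stuck: "\<forall>t. \<not> solve_step H C (Directions D Sp Sd) t"
    have False
    proof (cases "D = {}")
      case True
      then show False
        using stuck solve_step.directions_done[of H C Sp Sd] by blast
    next
      case False
      then obtain y where "y \<in> D"
        by blast
      then show False
        using stuck solve_step.direction_start[of y D H C Sp Sd] by blast
    qed
    then show "Q (Directions D Sp Sd)" ..
  qed
qed

lemma totally_correct_Points:
  assumes no_improving: "\<nexists>d e. improving_direction G C d e"
    and "finite P" "\<And>y. y \<in> P \<Longrightarrow> \<exists>x. y \<in> H x"
    and "finite Sp" "\<And>x. x \<in> Sp \<Longrightarrow> minimizing_point H C x"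
    and "\<And>Sp'. finite Sp' \<Longrightarrow> Sp \<subseteq> Sp' \<Longrightarrow> (\<And>x. x \<in> Sp' \<Longrightarrow> minimizing_point H C x) \<Longrightarrow>
      (\<And>y. y \<in> P \<Longrightarrow> \<exists>x\<in>Sp'. y \<in> H x) \<Longrightarrow>
      totally_correct (solve_step H C) Q (Directions D Sp' Sd)"
  shows "totally_correct (solve_step H C) Q (Points P D Sp Sd)"
  using assms(2-)
proof (induction "card P" arbitrary: P Sp rule: less_induct)
  case less
  show ?case
  proof (rule totally_correctI)
    fix t
    assume "solve_step H C (Points P D Sp Sd) t"
    then show "totally_correct (solve_step H C) Q t"
    proof cases
      case (point_start y)
      let ?call = "\<lambda>s. Point_Call s (P - {y}) D Sp Sd"
      obtain x where "y \<in> H x"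
        using less.prems(2) point_start(2) by blast
      then have "totally_correct (cm_step H C)
        (\<lambda>s. \<exists>X. s = CM_Return X \<and> cm_result H G C y X) (CM_Start y)"
        by (rule totally_correct_CM_Start)
      then show ?thesis
        unfolding point_start(1)
      proof (rule totally_correct_embed[where f = ?call])
        show "solve_step H C (?call s) (?call s')" if "cm_step H C s s'" for s s'
          using that by (rule solve_step.point_step)
        show "(\<exists>s'. cm_step H C s s' \<and> t = ?call s') \<or> (\<forall>s'. \<not> cm_step H C s s')"
          if "solve_step H C (?call s) t" for s t
          using that by cases (auto simp: not_cm_step_CM_Return)
        show "\<exists>t. solve_step H C (?call s) t"
          if "\<exists>X. s = CM_Return X \<and> cm_result H G C y X" for s
          using that by (auto intro: solve_step.point_return)
        show "totally_correct (solve_step H C) Q t"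
          if result: "\<exists>X. s = CM_Return X \<and> cm_result H G C y X" and t: "solve_step H C (?call s) t"
          for s t
        proof -
          obtain x where x: "s = CM_Return {x}" "minimizing_point H C x" "y \<in> H x"
            using result no_improving by (auto simp: cm_result_def)
          have "t = Points (P - {y}) D (Sp \<union> {x}) Sd"
            using t unfolding x(1) by cases (auto simp: not_cm_step_CM_Return)
          moreover have "totally_correct (solve_step H C) Q (Points (P - {y}) D (Sp \<union> {x}) Sd)"
          proof (rule less.hyps)
            show "card (P - {y}) < card P"
              using less.prems(1) point_start(2) by (rule card_Diff1_less)
            fix Sp'
            assume "finite Sp'" "Sp \<union> {x} \<subseteq> Sp'"
              "\<And>x. x \<in> Sp' \<Longrightarrow> minimizing_point H C x"
              "\<And>y'. y' \<in> P - {y} \<Longrightarrow> \<exists>x\<in>Sp'. y' \<in> H x"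
            then show "totally_correct (solve_step H C) Q (Directions D Sp' Sd)"
              using x(3) by (intro less.prems(5)) blast+
          qed (use less.prems(1-4) x(2) in auto)
          ultimately show ?thesis
            by simp
        qed
      qed
    next
      case points_done
      then show ?thesis
        unfolding points_done(2) by (intro less.prems(5)) (use less.prems(3,4) in auto)
    qed
  next
    assume stuck: "\<forall>t. \<not> solve_step H C (Points P D Sp Sd) t"
    have False
    proof (cases "P = {}")
      case True
      then show False
        using stuck solve_step.points_done[of H C D Sp Sd] by blast
    next
      case False
      then obtain y where "y \<in> P"
        by blast
      then show False
        using stuck solve_step.point_start[of y P H C D Sp Sd] by blast
    qed
    then show "Q (Points P D Sp Sd)" ..
  qed
qed

definition correct_output :: "('a, 'b) solve_state \<Rightarrow> bool" where
  "correct_output s \<longleftrightarrow> (\<exists>Sp Sd. s = Output Sp Sd \<and>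
    (if \<exists>Tp Td. is_solution H C Tp Td then is_solution H C Sp Sd else Sp = {} \<and> Sd = {}))"

text \<open>Every call needs an admissible starting point. For a point \<open>y\<close> it exists
  because \<open>y\<close> lies in the upper image; for a direction, because the rays along it stay
  in the upper image and \<open>ray_of_upper_image\<close> applies.\<close>

lemma totally_correct_Points_init:
  assumes no_improving: "\<nexists>d e. improving_direction G C d e"
    and ne: "upper_image H C \<noteq> {}" and V: "V_representation (upper_image H C) P R"
  shows "totally_correct (solve_step H C) correct_output (Points P (R - C) {} {})"
proof -
  have fin: "finite P" "finite R" and eq: "upper_image H C = convex hull P + convex_cone hull R"
    using V by (auto simp: V_representation_def)
  have sum: "p + r \<in> upper_image H C" if "p \<in> P" "r \<in> convex_cone hull R" for p r
    unfolding eq using that by (intro set_plus_intro) (auto simp: hull_inc)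
  have P: "\<exists>x. y \<in> H x" if "y \<in> P" for y
    using sum[OF that convex_cone_hull_contains_0] by (simp add: upper_image_eq)
  have R: "y \<notin> C \<and> (\<exists>x. y \<in> G x)" if y: "y \<in> R - C" for y
  proof -
    obtain p where "p \<in> P"
      using ne eq by fastforce
    then have "p + t *\<^sub>R y \<in> upper_image H C" if "t \<ge> 0" for t
      using that y by (intro sum) (auto simp: convex_cone_hull_mul hull_inc)
    moreover have "p \<in> upper_image H C"
      using sum[OF \<open>p \<in> P\<close> convex_cone_hull_contains_0] by simp
    ultimately show ?thesis
      using ray_of_upper_image y by blast
  qed
  show ?thesis
  proof (rule totally_correct_Points[OF no_improving fin(1) P])
    fix Sp
    assume Sp: "finite Sp" "\<And>x. x \<in> Sp \<Longrightarrow> minimizing_point H C x"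
      "\<And>y. y \<in> P \<Longrightarrow> \<exists>x\<in>Sp. y \<in> H x"
    show "totally_correct (solve_step H C) correct_output (Directions (R - C) Sp {})"
    proof (rule totally_correct_Directions[OF no_improving _ R])
      fix Sd
      assume Sd: "finite Sd" "\<And>x. x \<in> Sd \<Longrightarrow> minimizing_direction H C x"
        "\<And>y. y \<in> R - C \<Longrightarrow> \<exists>x\<in>Sd. y \<in> G x"
      have "is_solution H C Sp Sd"
        by (rule is_solution_if_covering[OF V ne Sp Sd])
      then show "correct_output (Output Sp Sd)"
        by (auto simp: correct_output_def)
    qed (use fin in auto)
  qed auto
qed

text \<open>The upper image is a projection of the graph. Existence of a representation ensures that
  a run is not stuck after a successful test.\<close>

lemma V_representation_upper_image:
  obtains P R where "V_representation (upper_image H C) P R"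
proof -
  obtain P R where "V_representation (graph_of H) P R"
    using polyhedron_V_representation[OF polyhedral[unfolded polyhedral_convex_def]] by blast
  then have "V_representation (snd ` graph_of H) (snd ` P) (snd ` R)"
    by (rule V_representation_linear_image[OF linear_snd])
  moreover have "upper_image H C = snd ` graph_of H"
    by (auto simp: upper_image_eq graph_of_def image_def)
  ultimately show thesis
    using that by simp
qed

lemma totally_correct_Init: "totally_correct (solve_step H C) correct_output Init"
proof -
  interpret G: polyhedral_mapping G G C
    by (rule polyhedral_mapping_recession)
  have empty_output: "totally_correct (solve_step H C) correct_output (Output {} {})"
    if "\<And>Sp Sd. \<not> is_solution H C Sp Sd"
    using that by (intro totally_correct_Output) (simp add: correct_output_def)
  have check: "totally_correct (solve_step H C) correct_output (Check (CM_Start 0))"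
    if ne: "upper_image H C \<noteq> {}"
  proof -
    have "0 \<in> G 0"
      using convex_cone_contains_0[OF convex_cone_C] by (simp add: G_0)
    then have "totally_correct (cm_step G C)
      (\<lambda>s. \<exists>X. s = CM_Return X \<and> cm_result G G C 0 X) (CM_Start 0)"
      by (rule G.totally_correct_CM_Start)
    then show ?thesis
    proof (rule totally_correct_embed[where f = Check])
      show "solve_step H C (Check s) (Check s')" if "cm_step G C s s'" for s s'
        using that by (simp add: solve_step.check_step recession)
      show "(\<exists>s'. cm_step G C s s' \<and> t = Check s') \<or> (\<forall>s'. \<not> cm_step G C s s')"
        if "solve_step H C (Check s) t" for s t
        using that by cases (auto simp: recession not_cm_step_CM_Return)
      show "\<exists>t. solve_step H C (Check s) t"
        if result: "\<exists>X. s = CM_Return X \<and> cm_result G G C 0 X" for s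
      proof -
        obtain X where X: "s = CM_Return X"
          using result by blast
        obtain P R where "V_representation (upper_image H C) P R"
          by (rule V_representation_upper_image)
        then show ?thesis
          unfolding X using solve_step.check_fail[of H C] solve_step.check_succeed[of X H C P R]
          by (cases "X = {}") blast+
      qed
      show "totally_correct (solve_step H C) correct_output t"
        if result: "\<exists>X. s = CM_Return X \<and> cm_result G G C 0 X"
          and t: "solve_step H C (Check s) t" for s t
      proof -
        obtain X where X: "s = CM_Return X" "cm_result G G C 0 X"
          using result by blast
        from t show ?thesis
          unfolding X(1)
        proof cases
          case (check_step s')
          then show ?thesis
            by (simp add: not_cm_step_CM_Return)
        next
          case check_fail
          then obtain d e where "improving_direction G C d e"
            using X(2) by (auto simp: cm_result_def)
          then show ?thesis
            unfolding check_fail(2)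
            by (intro empty_output no_solution_if_improving_direction)
        next
          case (check_succeed P R)
          then obtain x where "minimizing_point G C x"
            using X(2) by (auto simp: cm_result_def)
          \<comment> \<open>The exclusion lemma is used for the instance with \<open>G\<close> in
            place of \<open>H\<close>; the improving directions are the same for both.\<close>
          then have "\<nexists>d e. improving_direction G C d e"
            using G.no_minimizing_point_if_improving_direction by blast
          then show ?thesis
            unfolding check_succeed(1) by (intro totally_correct_Points_init ne check_succeed(3))
        qed
      qed
    qed
  qed
  show ?thesis
  proof (rule totally_correctI)
    fix t
    assume "solve_step H C Init t"
    then show "totally_correct (solve_step H C) correct_output t"
    proof cases
      case empty_image
      then show ?thesis
        using empty_output[OF no_solution_if_empty_upper_image] by simp
    next
      case check_start
      then show ?thesis
        by (simp add: check)
    qed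
  next
    assume "\<forall>t. \<not> solve_step H C Init t"
    then show "correct_output Init"
      using solve_step.empty_image[of H C] solve_step.check_start[of H C] by blast
  qed
qed

end

theorem theorem5p6:
  fixes F :: "real^'n \<Rightarrow> (real^'q) set" and G :: "real^'n \<Rightarrow> (real^'q) set" and C :: "(real^'q) set"
  assumes "polyhedral_convex F"
    and "G = recession_map F"
    and "polyhedron C" and "convex_cone C" and "interior C \<noteq> {}"
    and "G 0 = C"
  shows "\<not> (\<exists>s. s 0 = Init \<and> (\<forall>i::nat. solve_step F C (s i) (s (Suc i)))) \<and>
    (\<forall>s. (solve_step F C)\<^sup>*\<^sup>* Init s \<and> \<not> (\<exists>s'. solve_step F C s s') \<longrightarrow>
      (\<exists>Sp Sd. s = Output Sp Sd \<and>
        (if \<exists>Tp Td. is_solution F C Tp Td then is_solution F C Sp Sd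
         else Sp = {} \<and> Sd = {})))"
proof -
  interpret polyhedral_mapping F G C
    using assms by unfold_locales auto
  show ?thesis
  proof (intro conjI allI impI)
    show "\<not> (\<exists>s. s 0 = Init \<and> (\<forall>i::nat. solve_step F C (s i) (s (Suc i))))"
    proof (intro notI, elim exE conjE)
      fix s
      assume "s 0 = Init" and run: "\<forall>i::nat. solve_step F C (s i) (s (Suc i))"
      then have "totally_correct (solve_step F C) correct_output (s 0)"
        by (simp only: totally_correct_Init)
      then show False
        using totally_correct_no_infinite_run run by blast
    qed
    fix s
    assume "(solve_step F C)\<^sup>*\<^sup>* Init s \<and> \<not> (\<exists>s'. solve_step F C s s')"
    then have "correct_output s"
      using totally_correct_final[OF _ totally_correct_Init] by blast
    then show "\<exists>Sp Sd. s = Output Sp Sd \<and>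
        (if \<exists>Tp Td. is_solution F C Tp Td then is_solution F C Sp Sd
         else Sp = {} \<and> Sd = {})"
      by (simp only: correct_output_def)
  qed
qed

end
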